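(* Let $(\Omega,\mathcal{F},\mathbb{P})$ be a nonatomic probability space and let $(\mathcal{X},\mathcal{X}^\ast)$ be a pair of law-invariant vector subspaces of $L^1$, each containing $L^\infty$, such that $XY\in L^1$ for all $X\in\mathcal{X}$ and $Y\in\mathcal{X}^\ast$. Let $\varphi:\mathcal{X}\to(-\infty,\infty]$ be proper, convex, $\sigma(\mathcal{X},\mathcal{X}^\ast)$-lower semicontinuous and law invariant. Then the following statements are equivalent: (a) $\varphi$ is affine along some nonconstant $Z\in\mathcal{X}$ with $\mathbb{E}_{\mathbb{P}}[Z]\neq 0$; (b) $\varphi$ is translation invariant along some nonconstant $Z\in\mathcal{X}$ with $\mathbb{E}_{\mathbb{P}}[Z]\neq 0$; (c) there exists $a\in\mathbb{R}$ such that $\varphi(X)=a\,\mathbb{E}_{\mathbb{P}}[X]+\varphi(0)$ for every $X\in\mathcal{X}$.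
   Context: $L^0$ denotes the space of real random variables on $(\Omega,\mathcal{F},\mathbb{P})$ modulo almost-sure equality; real numbers are identified with a.s. constant random variables, and "nonconstant" means not a.s. constant. $L^p$ are the usual Lebesgue spaces. For $X,Y\in L^0$, $X\sim Y$ means $X$ and $Y$ have the same law under $\mathbb{P}$. A set $\mathcal{S}\subset L^0$ is law invariant if $X\in\mathcal{S}$ whenever $X\in L^0$ and $X\sim Y$ for some $Y\in\mathcal{S}$. $\sigma(\mathcal{X},\mathcal{X}^\ast)$ is the weakest linear topology on $\mathcal{X}$ for which $X\mapsto\mathbb{E}_{\mathbb{P}}[XY]$ is continuous for every $Y\in\mathcal{X}^\ast$. For $\varphi:\mathcal{X}\to(-\infty,\infty]$: $\mathrm{dom}(\varphi)=\{X:\varphi(X)<\infty\}$; $\varphi$ is proper if $\mathrm{dom}(\varphi)\neq\emptyset$; convex in the usual sense; law invariant if $\varphi(X)=\varphi(Y)$ whenever $X\sim Y$; $\sigma(\mathcal{X},\mathcal{X}^\ast)$-lower semicontinuous if for every net $X_\alpha\to X$ in $\sigma(\mathcal{X},\mathcal{X}^\ast)$ one has $\varphi(X)\le\liminf_\alpha\varphi(X_\alpha)$. For a linear subspace $\mathcal{M}\subset\mathcal{X}$, $\varphi$ is affine along $\mathcal{M}$ if $\mathcal{M}\subset\mathrm{dom}(\varphi)$ and $Z\mapsto\varphi(Z)-\varphi(0)$ is linear on $\mathcal{M}$; $\varphi$ is translation invariant along $\mathcal{M}$ if it is affine along $\mathcal{M}$ and $\varphi(X+Z)=\varphi(X)+\varphi(Z)-\varphi(0)$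 for all $X\in\mathcal{X}$, $Z\in\mathcal{M}$. "Along $Z$" means along $\mathrm{span}(Z)=\{mZ:m\in\mathbb{R}\}$. *)

theory Defs
  imports "HOL-Probability.Probability"
begin

text \<open>Random variables are represented by real-valued functions on the sample space;
  all notions below are invariant under almost-sure equality (law-invariant sets and
  functionals automatically are), so this models L^0 faithfully.\<close>

definition nonatomic :: "'a measure \<Rightarrow> bool" where
  "nonatomic M \<longleftrightarrow> (\<forall>A\<in>sets M. measure M A > 0 \<longrightarrow>
     (\<exists>B\<in>sets M. B \<subseteq> A \<and> 0 < measure M B \<and> measure M B < measure M A))"

definition same_law :: "'a measure \<Rightarrow> ('a \<Rightarrow> real) \<Rightarrow> ('a \<Rightarrow> real) \<Rightarrow> bool" where
  "same_law M X Y \<longleftrightarrow> X \<in> borel_measurable M \<and> Y \<in> borel_measurable M \<and>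
     distr M borel X = distr M borel Y"

definition law_invariant_set :: "'a measure \<Rightarrow> ('a \<Rightarrow> real) set \<Rightarrow> bool" where
  "law_invariant_set M S \<longleftrightarrow> (\<forall>X Y. Y \<in> S \<longrightarrow> same_law M X Y \<longrightarrow> X \<in> S)"

definition linear_subspace_rv :: "('a \<Rightarrow> real) set \<Rightarrow> bool" where
  "linear_subspace_rv S \<longleftrightarrow> (\<lambda>_. 0) \<in> S \<and>
     (\<forall>X\<in>S. \<forall>Y\<in>S. (\<lambda>w. X w + Y w) \<in> S) \<and> (\<forall>c::real. \<forall>X\<in>S. (\<lambda>w. c * X w) \<in> S)"

definition contains_Linf :: "'a measure \<Rightarrow> ('a \<Rightarrow> real) set \<Rightarrow> bool" where
  "contains_Linf M S \<longleftrightarrow> (\<forall>X \<in> borel_measurable M. (\<exists>C. AE w in M. \<bar>X w\<bar> \<le> C) \<longrightarrow> X \<in> S)"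

definition subset_L1 :: "'a measure \<Rightarrow> ('a \<Rightarrow> real) set \<Rightarrow> bool" where
  "subset_L1 M S \<longleftrightarrow> (\<forall>X\<in>S. integrable M X)"

definition proper_on :: "('a \<Rightarrow> real) set \<Rightarrow> (('a \<Rightarrow> real) \<Rightarrow> ereal) \<Rightarrow> bool" where
  "proper_on S \<phi> \<longleftrightarrow> (\<exists>X\<in>S. \<phi> X < \<infinity>)"

definition convex_on_rv :: "('a \<Rightarrow> real) set \<Rightarrow> (('a \<Rightarrow> real) \<Rightarrow> ereal) \<Rightarrow> bool" where
  "convex_on_rv S \<phi> \<longleftrightarrow> (\<forall>X\<in>S. \<forall>Y\<in>S. \<forall>t::real. 0 \<le> t \<and> t \<le> 1 \<longrightarrow>
     \<phi> (\<lambda>w. t * X w + (1 - t) * Y w) \<le> ereal t * \<phi> X + ereal (1 - t) * \<phi> Y)"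

definition law_invariant_fun :: "'a measure \<Rightarrow> ('a \<Rightarrow> real) set \<Rightarrow> (('a \<Rightarrow> real) \<Rightarrow> ereal) \<Rightarrow> bool" where
  "law_invariant_fun M S \<phi> \<longleftrightarrow> (\<forall>X\<in>S. \<forall>Y\<in>S. same_law M X Y \<longrightarrow> \<phi> X = \<phi> Y)"

text \<open>Convergence in sigma(X, X*) along a filter F (nets correspond to filters), and
  net lower semicontinuity: for every net (filter) in S converging weakly to X in S,
  phi X <= liminf.\<close>

definition weak_tendsto :: "'a measure \<Rightarrow> ('a \<Rightarrow> real) set \<Rightarrow> ('a \<Rightarrow> real) \<Rightarrow> ('a \<Rightarrow> real) filter \<Rightarrow> bool" where
  "weak_tendsto M Sd X F \<longleftrightarrow>
     (\<forall>Y\<in>Sd. ((\<lambda>V. integral\<^sup>L M (\<lambda>w. V w * Y w)) \<longlongrightarrow> integral\<^sup>L M (\<lambda>w. X w * Y w)) F)"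

definition weak_lsc :: "'a measure \<Rightarrow> ('a \<Rightarrow> real) set \<Rightarrow> ('a \<Rightarrow> real) set \<Rightarrow> (('a \<Rightarrow> real) \<Rightarrow> ereal) \<Rightarrow> bool" where
  "weak_lsc M S Sd \<phi> \<longleftrightarrow> (\<forall>F X. F \<le> principal S \<longrightarrow> X \<in> S \<longrightarrow> weak_tendsto M Sd X F \<longrightarrow>
     \<phi> X \<le> Liminf F \<phi>)"

definition rv_span :: "('a \<Rightarrow> real) \<Rightarrow> ('a \<Rightarrow> real) set" where
  "rv_span Z = {(\<lambda>w. m * Z w) | m::real. True}"

definition affine_along :: "('a \<Rightarrow> real) set \<Rightarrow> (('a \<Rightarrow> real) \<Rightarrow> ereal) \<Rightarrow> bool" where
  "affine_along N \<phi> \<longleftrightarrow> (\<forall>Z\<in>N. \<phi> Z < \<infinity>) \<and>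
     (\<forall>Z1\<in>N. \<forall>Z2\<in>N. \<forall>a b::real.
        \<phi> (\<lambda>w. a * Z1 w + b * Z2 w) - \<phi> (\<lambda>_. 0) =
          ereal a * (\<phi> Z1 - \<phi> (\<lambda>_. 0)) + ereal b * (\<phi> Z2 - \<phi> (\<lambda>_. 0)))"

definition translation_invariant_along :: "('a \<Rightarrow> real) set \<Rightarrow> ('a \<Rightarrow> real) set \<Rightarrow> (('a \<Rightarrow> real) \<Rightarrow> ereal) \<Rightarrow> bool" where
  "translation_invariant_along S N \<phi> \<longleftrightarrow> affine_along N \<phi> \<and>
     (\<forall>X\<in>S. \<forall>Z\<in>N. \<phi> (\<lambda>w. X w + Z w) = \<phi> X + \<phi> Z - \<phi> (\<lambda>_. 0))"

definition nonconstant :: "'a measure \<Rightarrow> ('a \<Rightarrow> real) \<Rightarrow> bool" where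
  "nonconstant M Z \<longleftrightarrow> \<not> (\<exists>c. AE w in M. Z w = c)"

end

theory Submission
  imports Defs
begin

text \<open>
  If \<open>\<phi>\<close> is affine along \<open>Z\<close>, convexity and lower semicontinuity upgrade this to
  translation invariance, and by law invariance the same holds, with the same slope, along every copy
  of \<open>Z\<close>. Hence \<open>\<phi>\<close> is invariant under adding multiples of \<open>Z1 - Z2\<close> for any two copies of \<open>Z\<close>.
  The directions with this invariance form a weakly sequentially closed subspace, called \<open>flat\<close> below.
  Choose two values \<open>c \<noteq> d\<close> in the essential range of \<open>Z\<close>. On a nonatomic space \<open>Z\<close> has two copies that
  agree except on small disjoint sets \<open>U\<close>, \<open>V\<close> of equal probability, where their values near \<open>c\<close> and \<open>d\<close>
  are exchanged; their difference is close to \<open>(c - d) (1_U - 1_V)\<close>. Summing such differences and passing to limits shows that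
  \<open>flat\<close> contains \<open>1_A - P(A)\<close> for every event \<open>A\<close>, hence every centred element. So \<open>\<phi>\<close> depends on the mean
  only, and since \<open>E[Z] \<noteq> 0\<close> it is affine in the mean.
\<close>

section \<open>Nonatomic probability spaces\<close>

definition nested_below :: "'a measure \<Rightarrow> 'a set \<Rightarrow> 'a set \<Rightarrow> bool" where
  "nested_below M E F \<longleftrightarrow> E \<subseteq> F \<and> measure M E < measure M F"

context prob_space
begin

text \<open>\<open>L\<close> acts as the least upper bound of the members below level
  \<open>t\<close>. If one of them has largest probability, it is \<open>L\<close>; otherwise a
  countable union of members whose probabilities approach the supremum swallows all the others. Only
  the lower side is treated, since the upper side follows by taking complements.\<close>

lemma nested_chain_cut:
  assumes sets: "C \<subseteq> events"
    and chain: "\<And>E F. E \<in> C \<Longrightarrow> F \<in> C \<Longrightarrow> E = F \<or> nested_below M E F \<or> nested_below M F E"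
    and "0 \<le> t"
  obtains L where "L \<in> events" "prob L \<le> t"
    "\<And>E. E \<in> C \<Longrightarrow> prob E < t \<Longrightarrow> E = L \<or> nested_below M E L"
    "\<And>G. (\<And>E. E \<in> C \<Longrightarrow> prob E < t \<Longrightarrow> E \<subseteq> G) \<Longrightarrow> L \<subseteq> G"
proof -
  let ?Lo = "{E \<in> C. prob E < t}"
  consider "?Lo = {}" | L where "L \<in> ?Lo" "\<And>E. E \<in> ?Lo \<Longrightarrow> prob E \<le> prob L"
    | "?Lo \<noteq> {}" "\<And>E. E \<in> ?Lo \<Longrightarrow> \<exists>F\<in>?Lo. prob E < prob F"
    using not_le by blast
  then show ?thesis
  proof cases
    case 1
    then show ?thesis
      using \<open>0 \<le> t\<close> by (intro that[of "{}"]) auto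
  next
    case (2 L)
    show ?thesis
    proof (rule that[of L])
      fix E assume E: "E \<in> C" "prob E < t"
      then have "prob E \<le> prob L" using 2 by auto
      then have "\<not> nested_below M L E" by (simp add: nested_below_def)
      then show "E = L \<or> nested_below M E L"
        using chain[of E L] E 2 by blast
    qed (use 2 sets in auto)
  next
    case 3
    define s where "s = Sup (prob ` ?Lo)"
    have "\<exists>E\<in>?Lo. s - 1 / (real n + 1) < prob E" for n
    proof -
      have "s - 1 / (real n + 1) < Sup (prob ` ?Lo)"
        unfolding s_def by (simp add: field_simps)
      from less_cSupD[OF _ this] 3(1) show ?thesis by auto
    qed
    then obtain F where F: "\<And>n. F n \<in> ?Lo" "\<And>n. s - 1 / (real n + 1) < prob (F n)"
      by metis
    define L where "L = (\<Union>n. F n)"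
    have Fs: "F n \<in> events" for n using F(1) sets by auto
    \<comment> \<open>By nesting, a finite union of members is its largest term and so stays below
      \<open>t\<close>; continuity of the measure along these unions then bounds
      \<open>prob L\<close>.\<close>
    have G: "(\<Union>i\<le>n. F i) \<in> ?Lo" for n
    proof (induction n)
      case 0
      show ?case using F(1)[of 0] by simp
    next
      case (Suc n)
      have eq: "(\<Union>i\<le>Suc n. F i) = (\<Union>i\<le>n. F i) \<union> F (Suc n)"
        by (simp add: atMost_Suc Un_commute)
      have "(\<Union>i\<le>n. F i) \<subseteq> F (Suc n) \<or> F (Suc n) \<subseteq> (\<Union>i\<le>n. F i)"
        using chain[of "\<Union>i\<le>n. F i" "F (Suc n)"] Suc F(1)[of "Suc n"]
        unfolding nested_below_def by blast
      then have "(\<Union>i\<le>Suc n. F i) = F (Suc n) \<or> (\<Union>i\<le>Suc n. F i) = (\<Union>i\<le>n. F i)"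
        unfolding eq by blast
      then show ?case using Suc F(1)[of "Suc n"] by metis
    qed
    have lim: "(\<lambda>n. prob (\<Union>i\<le>n. F i)) \<longlonglongrightarrow> prob (\<Union>n. \<Union>i\<le>n. F i)"
      by (rule finite_Lim_measure_incseq) (use Fs in \<open>auto simp: incseq_def intro: order_trans\<close>)
    have "(\<Union>n. \<Union>i\<le>n. F i) = L" unfolding L_def by blast
    with lim have "prob L \<le> t"
      using G by (intro LIMSEQ_le_const2[of "\<lambda>n. prob (\<Union>i\<le>n. F i)"]) (auto intro!: exI[of _ 0] less_imp_le)
    show ?thesis
    proof (rule that[of L])
      show "L \<in> events" unfolding L_def using Fs by auto
      show "prob L \<le> t" by fact
      fix E assume E: "E \<in> C" "prob E < t"
      \<comment> \<open>The supremum \<open>s\<close> is not attained, so some \<open>F n\<close> is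
        strictly more probable than \<open>E\<close> and, by comparability, contains it.\<close>
      obtain E' where E': "E' \<in> ?Lo" "prob E < prob E'" using 3(2) E by auto
      have "prob E' \<le> s" unfolding s_def
        by (rule cSup_upper) (use E' in \<open>auto intro!: bdd_aboveI[of _ 1]\<close>)
      with E' have "0 < s - prob E" by simp
      then obtain n where n: "1 / (real n + 1) < s - prob E"
        using nat_approx_posE by (metis of_nat_Suc add.commute)
      then have less: "prob E < prob (F n)" using F(2)[of n] by simp
      then have "E \<subseteq> F n" using chain[of E "F n"] E F(1)[of n] by (auto simp: nested_below_def)
      moreover have "F n \<subseteq> L" unfolding L_def by auto
      moreover have "prob (F n) \<le> prob L"
        by (rule finite_measure_mono) (use Fs in \<open>auto simp: L_def\<close>)
      ultimately show "E = L \<or> nested_below M E L" using less by (auto simp: nested_below_def)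
    next
      fix G assume "\<And>E. E \<in> C \<Longrightarrow> prob E < t \<Longrightarrow> E \<subseteq> G"
      then show "L \<subseteq> G" unfolding L_def using F(1) by blast
    qed
  qed
qed

text \<open>
  A maximal chain for \<^const>\<open>nested_below\<close> attains every probability: at a missing value \<open>t\<close> the chain
  is cut into a lower part below \<open>L\<close> and an upper part above \<open>H\<close>, and either \<open>L\<close>, \<open>H\<close> or, by
  nonatomicity, a set strictly between them would extend the chain. Requiring a strict increase
  of the probability keeps null sets from stalling this argument.
\<close>

lemma nonatomic_nested_family:
  assumes "nonatomic M"
  obtains E :: "real \<Rightarrow> 'a set" where
    "\<And>t. 0 \<le> t \<Longrightarrow> t \<le> 1 \<Longrightarrow> E t \<in> events \<and> prob (E t) = t"
    "\<And>s t. 0 \<le> s \<Longrightarrow> s \<le> t \<Longrightarrow> t \<le> 1 \<Longrightarrow> E s \<subseteq> E t"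
proof -
  obtain C where C: "pred_on.maxchain events (nested_below M) C"
    using pred_on.Hausdorff by blast
  have sets: "C \<subseteq> events"
    and chain: "\<And>E F. E \<in> C \<Longrightarrow> F \<in> C \<Longrightarrow> E = F \<or> nested_below M E F \<or> nested_below M F E"
    using C unfolding pred_on.maxchain_def pred_on.chain_def by blast+
  \<comment> \<open>Maximality in the form used below: an event comparable with every member of
    \<open>C\<close> already belongs to \<open>C\<close>.\<close>
  have mem: "K \<in> C" if "K \<in> events"
    "\<And>E. E \<in> C \<Longrightarrow> E = K \<or> nested_below M E K \<or> nested_below M K E" for K
  proof (rule ccontr)
    assume "K \<notin> C"
    moreover have "pred_on.chain events (nested_below M) (insert K C)"
      using sets chain that unfolding pred_on.chain_def by blast
    ultimately show False using C unfolding pred_on.maxchain_def by blast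
  qed
  have ex: "\<exists>E\<in>C. prob E = t" if t: "0 \<le> t" "t \<le> 1" for t
  proof (rule ccontr)
    assume "\<not> ?thesis"
    then have neq: "prob E < t \<or> t < prob E" if "E \<in> C" for E using that by force
    obtain L where L: "L \<in> events" "prob L \<le> t"
      "\<And>E. E \<in> C \<Longrightarrow> prob E < t \<Longrightarrow> E = L \<or> nested_below M E L"
      "\<And>G. (\<And>E. E \<in> C \<Longrightarrow> prob E < t \<Longrightarrow> E \<subseteq> G) \<Longrightarrow> L \<subseteq> G"
      using nested_chain_cut[OF sets chain t(1)] by blast
    \<comment> \<open>Complements reverse the order, so cutting \<open>?D\<close> at
      \<open>1 - t\<close> and complementing back yields the set \<open>H\<close> that bounds the
      upper part of \<open>C\<close> from below.\<close>
    let ?D = "(\<lambda>E. space M - E) ` C"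
    have compl: "prob (space M - E) = 1 - prob E" "space M - (space M - E) = E" if "E \<in> events" for E
      using that prob_compl[of E] sets.sets_into_space[of E M] by auto
    have nb: "nested_below M (space M - E) (space M - F) \<longleftrightarrow> nested_below M F E"
      if "E \<in> events" "F \<in> events" for E F
      using that sets.sets_into_space[of E M] sets.sets_into_space[of F M]
      by (auto simp: nested_below_def compl)
    have D_sets: "?D \<subseteq> events" using sets by auto
    have D_chain: "E = F \<or> nested_below M E F \<or> nested_below M F E" if "E \<in> ?D" "F \<in> ?D" for E F
    proof -
      from that obtain E' F' where "E' \<in> C" "F' \<in> C" "E = space M - E'" "F = space M - F'" by blast
      then show ?thesis using chain[of E' F'] nb[of E' F'] nb[of F' E'] sets by blast
    qed
    have "0 \<le> 1 - t" using t by simp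
    from nested_chain_cut[OF D_sets D_chain this] obtain H' where H': "H' \<in> events" "prob H' \<le> 1 - t"
      "\<And>E. E \<in> ?D \<Longrightarrow> prob E < 1 - t \<Longrightarrow> E = H' \<or> nested_below M E H'"
      "\<And>G. (\<And>E. E \<in> ?D \<Longrightarrow> prob E < 1 - t \<Longrightarrow> E \<subseteq> G) \<Longrightarrow> H' \<subseteq> G"
      by blast
    define H where "H = space M - H'"
    have H: "H \<in> events" "t \<le> prob H" using H' by (auto simp: H_def compl)
    have H'_eq: "H' = space M - H" unfolding H_def using H'(1) compl by simp
    have H_above: "E = H \<or> nested_below M H E" if "E \<in> C" "t < prob E" for E
    proof -
      have E: "E \<in> events" using sets that by auto
      then have "space M - E = H' \<or> nested_below M (space M - E) H'"
        using that by (intro H'(3)) (auto simp: compl)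
      then have "space M - E = space M - H \<or> nested_below M H E"
        using nb[OF E H(1)] H'_eq by simp
      then show ?thesis using compl(2)[OF E] compl(2)[OF H(1)] by metis
    qed
    have sub_H: "G \<subseteq> H" if "G \<in> events" "\<And>E. E \<in> C \<Longrightarrow> t < prob E \<Longrightarrow> G \<subseteq> E" for G
    proof -
      have "H' \<subseteq> space M - G"
      proof (rule H'(4))
        fix E assume E: "E \<in> ?D" "prob E < 1 - t"
        then obtain E' where E': "E' \<in> C" "E = space M - E'" by auto
        with E sets have "t < prob E'" by (auto simp: compl)
        then show "E \<subseteq> space M - G" using that(2) E' by auto
      qed
      then show ?thesis using sets.sets_into_space[OF that(1)] by (auto simp: H_def)
    qed
    have "L \<subseteq> H"
    proof (rule sub_H)
      fix F assume F: "F \<in> C" "t < prob F"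
      show "L \<subseteq> F"
      proof (rule L(4))
        fix E assume "E \<in> C" "prob E < t"
        then show "E \<subseteq> F" using chain[of E F] F by (auto simp: nested_below_def)
      qed
    qed fact
    have L_below: "L \<subseteq> F" if "F \<in> C" "t < prob F" for F
      using H_above[OF that] \<open>L \<subseteq> H\<close> by (auto simp: nested_below_def)
    have H_bd: "E \<subseteq> H" if "E \<in> C" "prob E < t" for E
      using L(3)[OF that] \<open>L \<subseteq> H\<close> by (auto simp: nested_below_def)
    \<comment> \<open>If \<open>L\<close> had probability exactly \<open>t\<close>, it would be
      comparable with all of \<open>C\<close> and hence belong to it, although \<open>C\<close>
      misses the value \<open>t\<close>. The same applies to \<open>H\<close> below.\<close>
    have "prob L \<noteq> t"
    proof
      assume eq: "prob L = t"
      have "L \<in> C"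
      proof (rule mem)
        fix E assume "E \<in> C"
        then show "E = L \<or> nested_below M E L \<or> nested_below M L E"
          using neq[of E] L(3)[of E] L_below[of E] eq by (auto simp: nested_below_def)
      qed fact
      with neq[of L] eq show False by simp
    qed
    moreover have "prob H \<noteq> t"
    proof
      assume eq: "prob H = t"
      have "H \<in> C"
      proof (rule mem)
        fix E assume "E \<in> C"
        then show "E = H \<or> nested_below M E H \<or> nested_below M H E"
          using neq[of E] H_above[of E] H_bd[of E] eq by (auto simp: nested_below_def)
      qed fact
      with neq[of H] eq show False by simp
    qed
    ultimately have LH: "prob L < t" "t < prob H" using L(2) H(2) by auto
    have diff: "prob (H - L) = prob H - prob L"
      by (rule finite_measure_Diff) (use H L \<open>L \<subseteq> H\<close> in auto)
    then have "0 < prob (H - L)" "H - L \<in> events" using LH H(1) L(1) by auto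
    then obtain B where B: "B \<in> events" "B \<subseteq> H - L" "0 < prob B" "prob B < prob (H - L)"
      using \<open>nonatomic M\<close> unfolding nonatomic_def by blast
    define K where "K = L \<union> B"
    have "prob K = prob L + prob B"
      unfolding K_def by (rule finite_measure_Union) (use L B in auto)
    then have K: "K \<in> events" "nested_below M L K" "nested_below M K H"
      using B L \<open>L \<subseteq> H\<close> diff by (auto simp: K_def nested_below_def)
    \<comment> \<open>\<open>K\<close> lies strictly between \<open>L\<close> and \<open>H\<close>,
      hence is comparable with every member. Once inside \<open>C\<close> it would have to lie below
      \<open>L\<close> or above \<open>H\<close>, depending on its probability, which is
      impossible.\<close>
    have "K \<in> C"
    proof (rule mem)
      fix E assume "E \<in> C"
      then show "E = K \<or> nested_below M E K \<or> nested_below M K E"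
        using neq[of E] L(3)[of E] H_above[of E] K(2,3) by (auto simp: nested_below_def)
    qed fact
    with neq[of K] show False
      using L(3)[of K] H_above[of K] K(2,3) by (auto simp: nested_below_def)
  qed
  then obtain E where E: "\<And>t. 0 \<le> t \<Longrightarrow> t \<le> 1 \<Longrightarrow> E t \<in> C \<and> prob (E t) = t" by metis
  show ?thesis
  proof (rule that[of E])
    show "E t \<in> events \<and> prob (E t) = t" if "0 \<le> t" "t \<le> 1" for t using E[OF that] sets by auto
    show "E s \<subseteq> E t" if "0 \<le> s" "s \<le> t" "t \<le> 1" for s t
      using chain[of "E s" "E t"] E[of s] E[of t] that by (auto simp: nested_below_def)
  qed
qed

section \<open>Uniform variables and the realisation of prescribed laws\<close>

text \<open>\<open>V x\<close> is the level at which \<open>x\<close> enters the increasing family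
  \<open>E\<close>, so the event \<open>V x < s\<close> is squeezed between the sets
  \<open>E q\<close> with \<open>q < s\<close> and the set \<open>E s\<close>. The values 0 and 1
  occur with probability zero and are replaced, because a quantile function needs arguments strictly
  inside the unit interval.\<close>

lemma nonatomic_uniform:
  assumes "nonatomic M"
  obtains U :: "'a \<Rightarrow> real" where "U \<in> borel_measurable M" "\<And>x. 0 < U x" "\<And>x. U x < 1"
    "\<And>t. 0 \<le> t \<Longrightarrow> t \<le> 1 \<Longrightarrow> prob {x \<in> space M. U x \<le> t} = t"
proof -
  obtain E :: "real \<Rightarrow> 'a set" where
    E: "\<And>t. 0 \<le> t \<Longrightarrow> t \<le> 1 \<Longrightarrow> E t \<in> events \<and> prob (E t) = t"
      "\<And>s t. 0 \<le> s \<Longrightarrow> s \<le> t \<Longrightarrow> t \<le> 1 \<Longrightarrow> E s \<subseteq> E t"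
    using nonatomic_nested_family[OF assms] by blast
  \<comment> \<open>Rational levels make the sublevel sets of \<open>V\<close> countable unions,
    hence measurable; the extra element 1 keeps the set nonempty and \<open>V\<close> at most
    1.\<close>
  define T where "T x = insert 1 {q \<in> \<rat> \<inter> {0..1}. x \<in> E q}" for x
  define V where "V x = Inf (T x)" for x
  have T01: "0 \<le> q" "q \<le> 1" if "q \<in> T x" for q x using that by (auto simp: T_def)
  have ne: "T x \<noteq> {}" for x by (simp add: T_def)
  have bdd: "bdd_below (T x)" for x using T01(1) by (rule bdd_belowI)
  have V01: "0 \<le> V x" "V x \<le> 1" for x
  proof -
    show "0 \<le> V x" unfolding V_def using ne T01(1) by (rule cInf_greatest)
    show "V x \<le> 1" unfolding V_def by (rule cInf_lower[OF _ bdd]) (simp add: T_def)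
  qed
  have lt: "V x < s \<longleftrightarrow> (\<exists>q\<in>T x. q < s)" for x s
    unfolding V_def by (rule cInf_less_iff[OF ne bdd])
  have eq: "{x \<in> space M. V x < s} = (\<Union>q\<in>\<rat> \<inter> {0..<s}. E q)" if "s \<le> 1" for s
  proof (intro set_eqI iffI)
    fix x assume "x \<in> {x \<in> space M. V x < s}"
    then obtain q where "q \<in> T x" "q < s" unfolding mem_Collect_eq lt by blast
    with \<open>s \<le> 1\<close> have "q \<in> \<rat> \<inter> {0..<s}" "x \<in> E q" unfolding T_def by auto
    then show "x \<in> (\<Union>q\<in>\<rat> \<inter> {0..<s}. E q)" by blast
  next
    fix x assume "x \<in> (\<Union>q\<in>\<rat> \<inter> {0..<s}. E q)"
    then obtain q where q: "q \<in> \<rat>" "0 \<le> q" "q < s" "x \<in> E q" by (meson IntD1 IntD2 UN_E atLeastLessThan_iff)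
    then have "x \<in> space M" using E(1)[of q] \<open>s \<le> 1\<close> sets.sets_into_space[of "E q" M] by force
    moreover have "q \<in> T x" using q \<open>s \<le> 1\<close> by (simp add: T_def)
    ultimately show "x \<in> {x \<in> space M. V x < s}" using q(3) unfolding mem_Collect_eq lt by blast
  qed
  have meas: "{x \<in> space M. V x < s} \<in> events" for s
  proof (cases "s \<le> 1")
    case True
    have "countable (\<rat> \<inter> {0..<s})" using countable_rat by (rule countable_Int1)
    moreover have "E q \<in> events" if "q \<in> \<rat> \<inter> {0..<s}" for q using that True E(1)[of q] by simp
    ultimately show ?thesis unfolding eq[OF True] by (rule sets.countable_UN'')
  next
    case False
    then have "{x \<in> space M. V x < s} = space M" using V01(2) by (auto simp: not_le intro: le_less_trans)
    then show ?thesis by simp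
  qed
  have Vm[measurable]: "V \<in> borel_measurable M"
    using meas by (simp add: borel_measurable_iff_less)
  have Vlt: "prob {x \<in> space M. V x < s} = s" if s: "0 \<le> s" "s \<le> 1" for s
  proof (rule antisym)
    have "{x \<in> space M. V x < s} \<subseteq> E s"
      unfolding eq[OF s(2)] by (intro UN_least E(2)) (use s(2) in auto)
    then show "prob {x \<in> space M. V x < s} \<le> s"
      using finite_measure_mono[of "{x \<in> space M. V x < s}" "E s"] E(1)[OF s] by auto
    show "s \<le> prob {x \<in> space M. V x < s}"
    proof (rule dense_le)
      fix r assume "r < s"
      then obtain q where q: "r < q" "q < s" "q \<in> \<rat>" using Rats_dense_in_real by blast
      show "r \<le> prob {x \<in> space M. V x < s}"
      proof (cases "0 \<le> q")
        case True
        have "E q \<subseteq> {x \<in> space M. V x < s}"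
          unfolding eq[OF s(2)] by (rule UN_upper) (use q True in auto)
        then have "prob (E q) \<le> prob {x \<in> space M. V x < s}"
          by (rule finite_measure_mono) (rule meas)
        then show ?thesis using E(1)[of q] True q s by simp
      next
        case False
        then show ?thesis using q by (simp add: order_trans[of r 0])
      qed
    qed
  qed
  have Vle: "prob {x \<in> space M. V x \<le> t} = t" if t: "0 \<le> t" "t \<le> 1" for t
  proof (rule antisym)
    have "prob {x \<in> space M. V x < t} \<le> prob {x \<in> space M. V x \<le> t}"
      by (rule finite_measure_mono) auto
    then show "t \<le> prob {x \<in> space M. V x \<le> t}" using Vlt[OF t] by simp
    show "prob {x \<in> space M. V x \<le> t} \<le> t"
    proof (cases "t = 1")
      case False
      show ?thesis
      proof (rule dense_ge_bounded[of t 1])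
        show "t < 1" using t False by simp
        fix s assume s: "t < s" "s < 1"
        have "prob {x \<in> space M. V x \<le> t} \<le> prob {x \<in> space M. V x < s}"
          by (rule finite_measure_mono) (use s in auto)
        then show "prob {x \<in> space M. V x \<le> t} \<le> s" using Vlt[of s] s t by simp
      qed
    qed simp
  qed
  have AE: "AE x in M. 0 < V x \<and> V x < 1"
  proof -
    have "AE x in M. x \<in> {x \<in> space M. V x < 1}"
      using Vlt[of 1] by (intro AE_prob_1) simp
    moreover have "{x \<in> space M. V x \<le> 0} \<in> null_sets M"
      using Vle[of 0] by (auto simp: null_sets_def emeasure_eq_measure)
    then have "AE x in M. x \<notin> {x \<in> space M. V x \<le> 0}" by (rule AE_not_in)
    ultimately show ?thesis by eventually_elim auto
  qed
  define U where "U x = (if 0 < V x \<and> V x < 1 then V x else 1/2)" for x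
  have Um[measurable]: "U \<in> borel_measurable M" unfolding U_def by measurable
  show ?thesis
  proof (rule that[of U])
    fix t :: real assume t: "0 \<le> t" "t \<le> 1"
    have "prob {x \<in> space M. U x \<le> t} = prob {x \<in> space M. V x \<le> t}"
    proof (rule finite_measure_eq_AE)
      show "AE x in M. (x \<in> {x \<in> space M. U x \<le> t}) = (x \<in> {x \<in> space M. V x \<le> t})"
        using AE by eventually_elim (simp add: U_def)
    qed auto
    then show "prob {x \<in> space M. U x \<le> t} = t" using Vle[OF t] by simp
  qed (auto simp: U_def Um)
qed

text \<open>Inverse transform sampling: \<open>\<mu>.I\<close> is the generalised inverse of the
  distribution function, and \<open>g\<close> is its value at a uniform variable.\<close>

lemma nonatomic_ex_distr:
  assumes "nonatomic M" "real_distribution \<mu>"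
  obtains g where "g \<in> borel_measurable M" "distr M borel g = \<mu>"
proof -
  interpret \<mu>: cdf_distribution \<mu>
    using assms(2) by (simp add: cdf_distribution_def)
  obtain U :: "'a \<Rightarrow> real" where U: "U \<in> borel_measurable M" "\<And>x. 0 < U x" "\<And>x. U x < 1"
    "\<And>t. 0 \<le> t \<Longrightarrow> t \<le> 1 \<Longrightarrow> prob {x \<in> space M. U x \<le> t} = t"
    using nonatomic_uniform[OF assms(1)] by blast
  note [measurable] = U(1)
  define g where "g x = \<mu>.I (U x)" for x
  have g_le: "g x \<le> y \<longleftrightarrow> U x \<le> cdf \<mu> y" for x y
    unfolding g_def using \<mu>.pseudoinverse[of "U x" y] U(2,3) by simp
  have gm[measurable]: "g \<in> borel_measurable M"
    unfolding borel_measurable_iff_le g_le by measurable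
  have "distr M borel g = \<mu>"
  proof (rule cdf_unique)
    show "real_distribution (distr M borel g)" by simp
    show "cdf (distr M borel g) = cdf \<mu>"
    proof
      fix y
      have "cdf (distr M borel g) y = prob {x \<in> space M. g x \<le> y}"
        by (auto simp: cdf_def measure_distr vimage_def intro!: arg_cong[where f=prob])
      also have "\<dots> = cdf \<mu> y"
        unfolding g_le by (intro U(4) \<mu>.cdf_nonneg \<mu>.cdf_bounded_prob)
      finally show "cdf (distr M borel g) y = cdf \<mu> y" .
    qed
  qed fact
  with gm show ?thesis by (rule that)
qed

end

section \<open>Conditioning on an event and moving laws between events\<close>

text \<open>The conditional measure sees only \<open>A \<inter> E\<close>, and a proper part of this
  set in \<open>M\<close> is one of \<open>E\<close> as well. This allows the preceding
  constructions to be carried out inside an event.\<close>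

lemma nonatomic_uniform_measure:
  assumes "finite_measure M" "nonatomic M" "A \<in> sets M" "measure M A > 0"
  shows "nonatomic (uniform_measure M A)"
proof -
  interpret finite_measure M by fact
  have pos: "emeasure M A \<noteq> 0" using assms(4) by (auto simp: measure_def)
  show ?thesis
  unfolding nonatomic_def
  proof (intro ballI impI)
    fix E assume E: "E \<in> sets (uniform_measure M A)" "0 < measure (uniform_measure M A) E"
    then have "measure M (A \<inter> E) > 0" "A \<inter> E \<in> sets M"
      using assms pos by (auto simp: zero_less_divide_iff)
    then obtain B where B: "B \<in> sets M" "B \<subseteq> A \<inter> E" "0 < measure M B" "measure M B < measure M (A \<inter> E)"
      using assms(2) unfolding nonatomic_def by blast
    then have "A \<inter> B = B" by auto
    with B E assms pos show "\<exists>B\<in>sets (uniform_measure M A). B \<subseteq> E \<and> 0 < measure (uniform_measure M A) B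
        \<and> measure (uniform_measure M A) B < measure (uniform_measure M A) E"
      by (intro bexI[of _ B]) (auto simp: divide_strict_right_mono)
  qed
qed

context prob_space
begin

lemma uniform_measure_event:
  assumes "A \<in> events" "0 < prob A"
  shows "prob_space (uniform_measure M A)"
    and "\<And>B. B \<in> events \<Longrightarrow> measure (uniform_measure M A) B = prob (A \<inter> B) / prob A"
proof -
  have "emeasure M A \<noteq> 0" using assms(2) by (auto simp: measure_def)
  then show "prob_space (uniform_measure M A)"
    and "\<And>B. B \<in> events \<Longrightarrow> measure (uniform_measure M A) B = prob (A \<inter> B) / prob A"
    using assms by (auto intro!: prob_space_uniform_measure)
qed

text \<open>The conditional law of \<open>f\<close> given \<open>A\<close> is realised by a variable
  on the conditional space of \<open>B\<close>; since the two events are equally likely, the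
  normalising factors cancel. For null events \<open>f\<close> itself serves.\<close>

lemma nonatomic_transport:
  assumes "nonatomic M" and [measurable]: "A \<in> events" "B \<in> events" "(f :: 'a \<Rightarrow> real) \<in> borel_measurable M"
    and eq: "prob A = prob B"
  obtains g where "g \<in> borel_measurable M"
    "\<And>E. E \<in> sets borel \<Longrightarrow> prob (B \<inter> (g -` E \<inter> space M)) = prob (A \<inter> (f -` E \<inter> space M))"
proof (cases "prob A = 0")
  case True
  have "prob (C \<inter> D) = 0" if "prob C = 0" "C \<in> events" "D \<in> events" for C D
    using finite_measure_mono[of "C \<inter> D" C] that measure_nonneg[of M "C \<inter> D"] by simp
  with True eq show ?thesis by (intro that[of f]) auto
next
  case False
  then have pos: "0 < prob A" "0 < prob B" using eq by (auto simp: zero_less_measure_iff)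
  interpret A: prob_space "uniform_measure M A" by (rule uniform_measure_event) (use pos in auto)
  interpret B: prob_space "uniform_measure M B" by (rule uniform_measure_event) (use pos in auto)
  have "real_distribution (distr (uniform_measure M A) borel f)"
    by (rule A.real_distribution_distr) simp
  moreover have "nonatomic (uniform_measure M B)"
    by (rule nonatomic_uniform_measure) (use pos assms finite_measure_axioms in auto)
  ultimately obtain g where g: "g \<in> borel_measurable (uniform_measure M B)"
    "distr (uniform_measure M B) borel g = distr (uniform_measure M A) borel f"
    using B.nonatomic_ex_distr by blast
  have gm[measurable]: "g \<in> borel_measurable M" using g(1) by simp
  show ?thesis
  proof (rule that[of g])
    fix E :: "real set" assume [measurable]: "E \<in> sets borel"
    have "measure (distr (uniform_measure M B) borel g) E = measure (distr (uniform_measure M A) borel f) E"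
      using g(2) by simp
    then have "measure (uniform_measure M B) (g -` E \<inter> space M) = measure (uniform_measure M A) (f -` E \<inter> space M)"
      by (simp add: measure_distr)
    then show "prob (B \<inter> (g -` E \<inter> space M)) = prob (A \<inter> (f -` E \<inter> space M))"
      using pos eq by (simp add: uniform_measure_event(2))
  qed (rule gm)
qed

text \<open>A uniform variable for the conditional measure, rescaled by \<open>prob A\<close>. Its
  half-open slices cut \<open>A\<close> into disjoint pieces of prescribed probability, and the
  strict bounds ensure that no point falls outside the range of the slices.\<close>

lemma nonatomic_uniform_on:
  assumes "nonatomic M" and A: "A \<in> events" "0 < prob A"
  obtains v :: "'a \<Rightarrow> real" where "v \<in> borel_measurable M" "\<And>x. 0 < v x" "\<And>x. v x < prob A"
    "\<And>s t. 0 \<le> s \<Longrightarrow> s \<le> t \<Longrightarrow> t \<le> prob A \<Longrightarrow> prob {x \<in> A. s < v x \<and> v x \<le> t} = t - s"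
proof -
  interpret A: prob_space "uniform_measure M A" by (rule uniform_measure_event) (use A in auto)
  have "nonatomic (uniform_measure M A)"
    by (rule nonatomic_uniform_measure) (use assms finite_measure_axioms in auto)
  then obtain U :: "'a \<Rightarrow> real" where U: "U \<in> borel_measurable (uniform_measure M A)" "\<And>x. 0 < U x" "\<And>x. U x < 1"
    "\<And>t. 0 \<le> t \<Longrightarrow> t \<le> 1 \<Longrightarrow> A.prob {x \<in> space (uniform_measure M A). U x \<le> t} = t"
    using A.nonatomic_uniform by blast
  have [measurable]: "U \<in> borel_measurable M" "A \<in> events" using U(1) A by auto
  have cum: "prob {x \<in> A. prob A * U x \<le> s} = s" if "0 \<le> s" "s \<le> prob A" for s
  proof -
    have "A.prob {x \<in> space M. U x \<le> s / prob A} = s / prob A"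
      using U(4)[of "s / prob A"] that A(2) by simp
    then have "prob (A \<inter> {x \<in> space M. U x \<le> s / prob A}) = s"
      using A by (simp add: uniform_measure_event(2))
    moreover have "A \<inter> {x \<in> space M. U x \<le> s / prob A} = {x \<in> A. prob A * U x \<le> s}"
      using A(2) sets.sets_into_space[OF A(1)] by (auto simp: field_simps)
    ultimately show ?thesis by simp
  qed
  show ?thesis
  proof (rule that[of "\<lambda>x. prob A * U x"])
    fix s t :: real assume st: "0 \<le> s" "s \<le> t" "t \<le> prob A"
    have "{x \<in> A. s < prob A * U x \<and> prob A * U x \<le> t} =
        {x \<in> A. prob A * U x \<le> t} - {x \<in> A. prob A * U x \<le> s}" by auto
    moreover have "prob ({x \<in> A. prob A * U x \<le> t} - {x \<in> A. prob A * U x \<le> s}) = t - s"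
      using cum[of s] cum[of t] st by (subst finite_measure_Diff) auto
    ultimately show "prob {x \<in> A. s < prob A * U x \<and> prob A * U x \<le> t} = t - s" by simp
  qed (use U A in \<open>auto simp: zero_less_mult_iff\<close>)
qed

lemma nonatomic_subset_of_prob:
  assumes "nonatomic M" "A \<in> events" "0 < t" "t \<le> prob A"
  obtains B where "B \<in> events" "B \<subseteq> A" "prob B = t"
proof -
  obtain v :: "'a \<Rightarrow> real" where v: "v \<in> borel_measurable M" "\<And>x. 0 < v x" "\<And>x. v x < prob A"
    "\<And>s t. 0 \<le> s \<Longrightarrow> s \<le> t \<Longrightarrow> t \<le> prob A \<Longrightarrow> prob {x \<in> A. s < v x \<and> v x \<le> t} = t - s"
    using nonatomic_uniform_on[OF assms(1,2) less_le_trans[OF assms(3,4)]] by blast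
  have [measurable]: "v \<in> borel_measurable M" "A \<in> events" by fact+
  show ?thesis
    by (rule that[of "{x \<in> A. 0 < v x \<and> v x \<le> t}"]) (use v(4)[of 0 t] assms in auto)
qed

lemma prob_split3:
  assumes "A \<in> events" "B \<in> events" "Q \<in> events" "A \<inter> B = {}"
  shows "prob Q = prob (A \<inter> Q) + prob (B \<inter> Q) + prob ((space M - (A \<union> B)) \<inter> Q)"
proof -
  have "prob (A \<inter> Q) + prob (B \<inter> Q) = prob (A \<inter> Q \<union> B \<inter> Q)"
    by (rule finite_measure_Union[symmetric]) (use assms in auto)
  moreover have "prob (A \<inter> Q \<union> B \<inter> Q) + prob ((space M - (A \<union> B)) \<inter> Q)
      = prob ((A \<inter> Q \<union> B \<inter> Q) \<union> (space M - (A \<union> B)) \<inter> Q)"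
    by (rule finite_measure_Union[symmetric]) (use assms in auto)
  moreover have "(A \<inter> Q \<union> B \<inter> Q) \<union> (space M - (A \<union> B)) \<inter> Q = Q"
    using sets.sets_into_space[OF assms(3)] by auto
  ultimately show ?thesis by simp
qed

section \<open>Two copies of a variable that differ by a local swap\<close>

lemma same_lawI:
  assumes "X \<in> borel_measurable M" "Y \<in> borel_measurable M"
    "\<And>E. E \<in> sets borel \<Longrightarrow> prob (X -` E \<inter> space M) = prob (Y -` E \<inter> space M)"
  shows "same_law M X Y"
  unfolding same_law_def
proof (intro conjI measure_eqI)
  fix E assume "E \<in> sets (distr M borel X)"
  then show "emeasure (distr M borel X) E = emeasure (distr M borel Y) E"
    using assms by (simp add: emeasure_distr emeasure_eq_measure)
qed (use assms in auto)

text \<open>The parts of the law of \<open>f\<close> carried by \<open>A\<close>, by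
  \<open>B\<close> and by the remaining points are moved to \<open>U\<close>, to \<open>V\<close>
  and to the points remaining there, so their sum is unchanged.\<close>

lemma same_law_glue:
  assumes [measurable]: "A \<in> events" "B \<in> events" "U \<in> events" "V \<in> events"
    and disj: "A \<inter> B = {}" "U \<inter> V = {}"
    and [measurable]: "f \<in> borel_measurable M" "g \<in> borel_measurable M" "g' \<in> borel_measurable M"
      "h \<in> borel_measurable M"
    and U: "\<And>E. E \<in> sets borel \<Longrightarrow> prob (U \<inter> (g -` E \<inter> space M)) = prob (A \<inter> (f -` E \<inter> space M))"
    and V: "\<And>E. E \<in> sets borel \<Longrightarrow> prob (V \<inter> (g' -` E \<inter> space M)) = prob (B \<inter> (f -` E \<inter> space M))"
    and R: "\<And>E. E \<in> sets borel \<Longrightarrow> prob ((space M - (U \<union> V)) \<inter> (h -` E \<inter> space M))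
        = prob ((space M - (A \<union> B)) \<inter> (f -` E \<inter> space M))"
  shows "same_law M (\<lambda>x. if x \<in> U then g x else if x \<in> V then g' x else h x) f"
proof (rule same_lawI)
  let ?Z = "\<lambda>x. if x \<in> U then g x else if x \<in> V then g' x else h x"
  show Z[measurable]: "?Z \<in> borel_measurable M" by measurable
  fix E :: "real set" assume [measurable]: "E \<in> sets borel"
  have "U \<inter> (?Z -` E \<inter> space M) = U \<inter> (g -` E \<inter> space M)"
    "V \<inter> (?Z -` E \<inter> space M) = V \<inter> (g' -` E \<inter> space M)"
    "(space M - (U \<union> V)) \<inter> (?Z -` E \<inter> space M) = (space M - (U \<union> V)) \<inter> (h -` E \<inter> space M)"
    using disj(2) by (auto split: if_splits)
  moreover have "prob (?Z -` E \<inter> space M) = prob (U \<inter> (?Z -` E \<inter> space M))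
      + prob (V \<inter> (?Z -` E \<inter> space M)) + prob ((space M - (U \<union> V)) \<inter> (?Z -` E \<inter> space M))"
    by (rule prob_split3) (use disj in auto)
  moreover have "prob (f -` E \<inter> space M) = prob (A \<inter> (f -` E \<inter> space M))
      + prob (B \<inter> (f -` E \<inter> space M)) + prob ((space M - (A \<union> B)) \<inter> (f -` E \<inter> space M))"
    by (rule prob_split3) (use disj in auto)
  ultimately show "prob (?Z -` E \<inter> space M) = prob (f -` E \<inter> space M)"
    using U[of E] V[of E] R[of E] by simp
qed fact

text \<open>Transport preserves laws only, so a bound valid at every point of \<open>A\<close>
  survives on \<open>U\<close> almost surely: the complement of \<open>E\<close> receives no mass in
  either case.\<close>

lemma AE_transport:
  assumes [measurable]: "A \<in> events" "U \<in> events" "f \<in> borel_measurable M" "g \<in> borel_measurable M" "E \<in> sets borel"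
    and eq: "\<And>E. E \<in> sets borel \<Longrightarrow> prob (U \<inter> (g -` E \<inter> space M)) = prob (A \<inter> (f -` E \<inter> space M))"
    and "\<And>x. x \<in> A \<Longrightarrow> f x \<in> E"
  shows "AE x in M. x \<in> U \<longrightarrow> g x \<in> E"
proof -
  have "A \<inter> (f -` (- E) \<inter> space M) = {}" using assms(7) by auto
  then have "prob (U \<inter> (g -` (- E) \<inter> space M)) = 0" using eq[of "- E"] by simp
  then have "U \<inter> (g -` (- E) \<inter> space M) \<in> null_sets M"
    by (auto simp: null_sets_def emeasure_eq_measure)
  then have "AE x in M. x \<notin> U \<inter> (g -` (- E) \<inter> space M)" by (rule AE_not_in)
  with AE_space show ?thesis by eventually_elim auto
qed

text \<open>The two values are points of the essential range, the complement of all open sets that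
  \<open>Z\<close> hits with probability zero. If this range were a single point, \<open>Z\<close>
  would be almost surely constant.\<close>

lemma nonconstant_two_values:
  assumes [measurable]: "Z \<in> borel_measurable M" and "nonconstant M Z"
  obtains c d where "c \<noteq> d" "\<And>e. 0 < e \<Longrightarrow> 0 < prob {x \<in> space M. \<bar>Z x - c\<bar> < e}"
    "\<And>e. 0 < e \<Longrightarrow> 0 < prob {x \<in> space M. \<bar>Z x - d\<bar> < e}"
proof -
  define F where "F = {I. open I \<and> prob (Z -` I \<inter> space M) = 0}"
  \<comment> \<open>By the Lindelof property countably many members of \<open>F\<close> cover its
    union, so \<open>Z\<close> avoids the whole union almost surely.\<close>
  obtain F' where F': "F' \<subseteq> F" "countable F'" "\<Union>F' = \<Union>F"
    using Lindelof[of F] by (auto simp: F_def)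
  have "AE x in M. \<forall>I\<in>F'. Z x \<notin> I"
  proof (rule AE_ball_countable')
    fix I assume "I \<in> F'"
    then have I: "open I" "prob (Z -` I \<inter> space M) = 0" using F'(1) by (auto simp: F_def)
    have "Z -` I \<inter> space M \<in> events" using I(1) by (intro measurable_sets[OF assms(1)]) auto
    then have "Z -` I \<inter> space M \<in> null_sets M" using I(2) by (auto simp: null_sets_def emeasure_eq_measure)
    then have "AE x in M. x \<notin> Z -` I \<inter> space M" by (rule AE_not_in)
    with AE_space show "AE x in M. Z x \<notin> I" by eventually_elim auto
  qed fact
  then have AE: "AE x in M. Z x \<notin> \<Union>F"
    unfolding F'(3)[symmetric] by (auto elim!: eventually_mono)
  have pos: "0 < prob {x \<in> space M. \<bar>Z x - c\<bar> < e}" if "c \<notin> \<Union>F" "0 < e" for c e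
  proof (rule ccontr)
    assume "\<not> ?thesis"
    then have "prob {x \<in> space M. \<bar>Z x - c\<bar> < e} = 0" by (simp add: zero_less_measure_iff)
    moreover have "{x \<in> space M. \<bar>Z x - c\<bar> < e} = Z -` ball c e \<inter> space M"
      by (auto simp: dist_real_def abs_minus_commute)
    ultimately have "ball c e \<in> F" by (simp add: F_def)
    then show False using that by auto
  qed
  have "\<exists>x. Z x \<notin> \<Union>F"
  proof (rule ccontr)
    assume neg: "\<not> ?thesis"
    have "AE x in M. False" by (rule eventually_mono[OF AE]) (use neg in blast)
    then show False by simp
  qed
  then obtain x where x: "Z x \<notin> \<Union>F" by blast
  have "\<exists>d. d \<notin> \<Union>F \<and> d \<noteq> Z x"
  proof (rule ccontr)
    assume neg: "\<not> ?thesis"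
    have "AE y in M. Z y = Z x" by (rule eventually_mono[OF AE]) (use neg in blast)
    then show False using assms(2) unfolding nonconstant_def by blast
  qed
  then obtain d where d: "d \<notin> \<Union>F" "d \<noteq> Z x" by blast
  show ?thesis
    by (rule that[OF d(2)[symmetric] pos[OF x] pos[OF d(1)]])
qed

text \<open>\<open>Z1\<close> carries the part of \<open>Z\<close> on \<open>A\<close> to
  \<open>U\<close> and the part on \<open>B\<close> to \<open>V\<close>; \<open>Z2\<close> does the
  opposite. Both use the same \<open>h\<close> elsewhere, so the difference vanishes there. The
  error is confined to \<open>U\<close> and \<open>V\<close>, so that it does not accumulate when
  swaps on disjoint sets are added.\<close>

lemma nonatomic_swap:
  assumes nonatomic: "nonatomic M"
    and Z[measurable]: "Z \<in> borel_measurable M"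
    and [measurable]: "A \<in> events" "B \<in> events" "U \<in> events" "V \<in> events"
    and disj: "A \<inter> B = {}" "U \<inter> V = {}"
    and eq: "prob A = prob U" "prob B = prob U" "prob V = prob U"
    and A: "\<And>x. x \<in> A \<Longrightarrow> \<bar>Z x - c\<bar> < e" and B: "\<And>x. x \<in> B \<Longrightarrow> \<bar>Z x - d\<bar> < e"
  obtains Z1 Z2 where "same_law M Z1 Z" "same_law M Z2 Z"
    "AE x in M. \<bar>(Z1 x - Z2 x) - (c - d) * (indicator U x - indicator V x)\<bar>
      \<le> 2 * e * (indicator U x + indicator V x)"
proof -
  have "prob (space M - (A \<union> B)) = prob (space M - (U \<union> V))"
    using eq by (simp add: prob_compl finite_measure_Union disj)
  then obtain h where h: "h \<in> borel_measurable M"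
    "\<And>E. E \<in> sets borel \<Longrightarrow> prob ((space M - (U \<union> V)) \<inter> (h -` E \<inter> space M))
      = prob ((space M - (A \<union> B)) \<inter> (Z -` E \<inter> space M))"
    using nonatomic_transport[OF nonatomic _ _ Z, of "space M - (A \<union> B)" "space M - (U \<union> V)"] by auto
  obtain ua where ua: "ua \<in> borel_measurable M"
    "\<And>E. E \<in> sets borel \<Longrightarrow> prob (U \<inter> (ua -` E \<inter> space M)) = prob (A \<inter> (Z -` E \<inter> space M))"
    using nonatomic_transport[OF nonatomic _ _ Z, of A U] eq by auto
  obtain ub where ub: "ub \<in> borel_measurable M"
    "\<And>E. E \<in> sets borel \<Longrightarrow> prob (U \<inter> (ub -` E \<inter> space M)) = prob (B \<inter> (Z -` E \<inter> space M))"
    using nonatomic_transport[OF nonatomic _ _ Z, of B U] eq by auto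
  obtain va where va: "va \<in> borel_measurable M"
    "\<And>E. E \<in> sets borel \<Longrightarrow> prob (V \<inter> (va -` E \<inter> space M)) = prob (A \<inter> (Z -` E \<inter> space M))"
    using nonatomic_transport[OF nonatomic _ _ Z, of A V] eq by auto
  obtain vb where vb: "vb \<in> borel_measurable M"
    "\<And>E. E \<in> sets borel \<Longrightarrow> prob (V \<inter> (vb -` E \<inter> space M)) = prob (B \<inter> (Z -` E \<inter> space M))"
    using nonatomic_transport[OF nonatomic _ _ Z, of B V] eq by auto
  let ?Z1 = "\<lambda>x. if x \<in> U then ua x else if x \<in> V then vb x else h x"
  let ?Z2 = "\<lambda>x. if x \<in> U then ub x else if x \<in> V then va x else h x"
  have near: "z \<in> {y. \<bar>y - r\<bar> < e} \<longleftrightarrow> \<bar>z - r\<bar> < e" "{y. \<bar>y - r\<bar> < e} \<in> sets borel" for z r :: real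
    by auto
  have "AE x in M. x \<in> U \<longrightarrow> ua x \<in> {y. \<bar>y - c\<bar> < e}"
    by (rule AE_transport[OF _ _ Z ua(1) _ ua(2)]) (use A in auto)
  moreover have "AE x in M. x \<in> U \<longrightarrow> ub x \<in> {y. \<bar>y - d\<bar> < e}"
    by (rule AE_transport[OF _ _ Z ub(1) _ ub(2)]) (use B in auto)
  moreover have "AE x in M. x \<in> V \<longrightarrow> va x \<in> {y. \<bar>y - c\<bar> < e}"
    by (rule AE_transport[OF _ _ Z va(1) _ va(2)]) (use A in auto)
  moreover have "AE x in M. x \<in> V \<longrightarrow> vb x \<in> {y. \<bar>y - d\<bar> < e}"
    by (rule AE_transport[OF _ _ Z vb(1) _ vb(2)]) (use B in auto)
  ultimately have "AE x in M. \<bar>(?Z1 x - ?Z2 x) - (c - d) * (indicator U x - indicator V x)\<bar>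
      \<le> 2 * e * (indicator U x + indicator V x)"
  proof eventually_elim
    case (elim x)
    consider "x \<in> U" "x \<notin> V" | "x \<in> V" "x \<notin> U" | "x \<notin> U" "x \<notin> V" using disj by auto
    then show ?case using elim by cases (simp_all add: abs_if split: if_splits)
  qed
  moreover have "same_law M ?Z1 Z"
    by (rule same_law_glue[OF _ _ _ _ disj Z ua(1) vb(1) h(1) ua(2) vb(2) h(2)]) auto
  \<comment> \<open>The gluing is now applied with the roles of \<open>A\<close> and
    \<open>B\<close> exchanged.\<close>
  moreover have "same_law M ?Z2 Z"
    using disj h(2) by (intro same_law_glue[OF _ _ _ _ _ _ Z ub(1) va(1) h(1) ub(2) va(2)]) (auto simp: Un_commute)
  ultimately show ?thesis using that by blast
qed

end

section \<open>Directions of invariance\<close>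

lemma same_law_AE:
  assumes "X \<in> borel_measurable M" "Y \<in> borel_measurable M" "AE x in M. X x = Y x"
  shows "same_law M X Y"
  unfolding same_law_def using assms by (auto intro: distr_cong_AE)

lemma same_law_scale:
  assumes "same_law M X Y"
  shows "same_law M (\<lambda>x. m * X x) (\<lambda>x. m * Y x)"
proof -
  have X: "X \<in> borel_measurable M" and Y: "Y \<in> borel_measurable M"
    and eq: "distr M borel X = distr M borel Y"
    using assms by (auto simp: same_law_def)
  have "distr M borel (\<lambda>x. m * X x) = distr (distr M borel X) borel (\<lambda>y. m * y)"
    using X by (subst distr_distr) (auto simp: comp_def)
  also have "\<dots> = distr M borel (\<lambda>x. m * Y x)"
    unfolding eq using Y by (subst distr_distr) (auto simp: comp_def)
  finally show ?thesis using X Y by (simp add: same_law_def)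
qed

section \<open>The functional, its translations and weak limits\<close>

locale law_invariant_lsc = prob_space M for M :: "'a measure" +
  fixes S Sd :: "('a \<Rightarrow> real) set" and \<phi> :: "('a \<Rightarrow> real) \<Rightarrow> ereal"
  assumes nonatomic: "nonatomic M"
    and subspace: "linear_subspace_rv S"
    and law_S: "law_invariant_set M S"
    and L1: "subset_L1 M S"
    and Linf: "contains_Linf M S" and Linf_dual: "contains_Linf M Sd"
    and pairing: "\<And>X Y. X \<in> S \<Longrightarrow> Y \<in> Sd \<Longrightarrow> integrable M (\<lambda>w. X w * Y w)"
    and not_MInf: "\<And>X. X \<in> S \<Longrightarrow> \<phi> X \<noteq> - \<infinity>"
    and convex: "convex_on_rv S \<phi>"
    and lsc: "weak_lsc M S Sd \<phi>"
    and law_\<phi>: "law_invariant_fun M S \<phi>"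
begin

lemma integrable_S: "X \<in> S \<Longrightarrow> integrable M X"
  using L1 by (simp add: subset_L1_def)

lemma measurable_S [measurable_dest]: "X \<in> S \<Longrightarrow> X \<in> borel_measurable M"
  by (rule borel_measurable_integrable) (rule integrable_S)

lemma S_add: "X \<in> S \<Longrightarrow> Y \<in> S \<Longrightarrow> (\<lambda>w. X w + Y w) \<in> S"
  using subspace by (simp add: linear_subspace_rv_def)

lemma S_scale: "X \<in> S \<Longrightarrow> (\<lambda>w. c * X w) \<in> S" for c :: real
  using subspace by (simp add: linear_subspace_rv_def)

lemma S_diff: "X \<in> S \<Longrightarrow> Y \<in> S \<Longrightarrow> (\<lambda>w. X w - Y w) \<in> S"
  using S_add[of X "\<lambda>w. (-1) * Y w"] S_scale[of Y "-1"] by simp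

lemma S_bounded: "X \<in> borel_measurable M \<Longrightarrow> (\<And>w. \<bar>X w\<bar> \<le> C) \<Longrightarrow> X \<in> S"
  using Linf unfolding contains_Linf_def by (metis AE_I2)

lemma S_const: "(\<lambda>_. c) \<in> S" for c :: real
  by (rule S_bounded[of _ "\<bar>c\<bar>"]) auto

lemma S_law: "X \<in> S \<Longrightarrow> same_law M Y X \<Longrightarrow> Y \<in> S"
  using law_S unfolding law_invariant_set_def by blast

lemma \<phi>_law: "X \<in> S \<Longrightarrow> same_law M Y X \<Longrightarrow> \<phi> Y = \<phi> X"
  using law_\<phi> S_law unfolding law_invariant_fun_def by blast

text \<open>Testing against this element shows that weak convergence includes convergence of
  expectations.\<close>

lemma one_dual: "(\<lambda>_. 1) \<in> Sd"
  using Linf_dual unfolding contains_Linf_def by (elim ballE[of _ _ "\<lambda>_. 1"]) auto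

lemma integrable_dual: "Y \<in> Sd \<Longrightarrow> integrable M Y"
  using pairing[OF S_const[of 1]] by simp

text \<open>A sequence enters the filter formulation of lower semicontinuity through
  \<open>filtermap W sequentially\<close>. The majorants \<open>K\<close> make it unnecessary to
  know that the values of \<phi> converge.\<close>

lemma lsc_sequence:
  assumes W: "\<And>n. W n \<in> S" and V: "V \<in> S"
    and conv: "\<And>Y. Y \<in> Sd \<Longrightarrow>
      (\<lambda>n. integral\<^sup>L M (\<lambda>w. W n w * Y w)) \<longlonglongrightarrow> integral\<^sup>L M (\<lambda>w. V w * Y w)"
    and le: "\<And>n. \<phi> (W n) \<le> K n" and K: "K \<longlonglongrightarrow> k"
  shows "\<phi> V \<le> k"
proof -
  have "filtermap W sequentially \<le> principal S"
    using W by (simp add: le_principal eventually_filtermap)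
  moreover have "weak_tendsto M Sd V (filtermap W sequentially)"
    unfolding weak_tendsto_def using conv by (simp add: filterlim_filtermap)
  ultimately have "\<phi> V \<le> Liminf (filtermap W sequentially) \<phi>"
    using lsc V unfolding weak_lsc_def by blast
  also have "\<dots> \<le> liminf (\<lambda>n. \<phi> (W n))"
    by (rule Liminf_filtermap_le)
  also have "\<dots> \<le> liminf K"
    by (rule Liminf_mono) (use le in simp)
  also have "\<dots> = k"
    by (rule lim_imp_Liminf) (use K in auto)
  finally show ?thesis .
qed

text \<open>A recession argument: growth along one line controls growth along every parallel line.
  Mixing \<open>X\<close> with ever farther points of the line through \<open>V\<close>, with
  weights \<open>s n\<close> tending to zero, leads to \<open>X + m V\<close>, while the
  contribution of the far point tends to \<open>m * l\<close>.\<close>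

lemma affine_translation_le:
  assumes V: "V \<in> S" and aff: "\<And>m. \<phi> (\<lambda>w. m * V w) = ereal (f0 + m * l)" and X: "X \<in> S"
  shows "\<phi> (\<lambda>w. X w + m * V w) \<le> \<phi> X + ereal (m * l)"
proof (cases "\<phi> X")
  case (real x)
  define s where "s n = 1 / (real n + 1)" for n
  have s: "0 < s n" "s n \<le> 1" for n by (auto simp: s_def field_simps)
  have s0: "s \<longlonglongrightarrow> 0"
    unfolding s_def using LIMSEQ_inverse_real_of_nat by (simp add: inverse_eq_divide add.commute)
  define W where "W n = (\<lambda>w. (1 - s n) * X w + m * V w)" for n
  have W: "W n \<in> S" for n unfolding W_def by (intro S_add S_scale X V)
  \<comment> \<open>\<open>W n\<close> is a convex combination of \<open>X\<close> and the far point \<open>(m / s n) V\<close> of the affine line.\<close>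
  have le: "\<phi> (W n) \<le> ereal ((1 - s n) * x + s n * f0 + m * l)" for n
  proof -
    have eq: "W n = (\<lambda>w. (1 - s n) * X w + (1 - (1 - s n)) * (m / s n * V w))"
      using s[of n] by (simp add: W_def)
    have "\<phi> (W n) \<le> ereal (1 - s n) * \<phi> X + ereal (1 - (1 - s n)) * \<phi> (\<lambda>w. m / s n * V w)"
      unfolding eq
      by (rule convex[unfolded convex_on_rv_def, rule_format, OF X S_scale[OF V]])
        (use s[of n] in simp)
    also have "\<dots> = ereal ((1 - s n) * x + s n * (f0 + m / s n * l))"
      unfolding real aff by simp
    also have "\<dots> = ereal ((1 - s n) * x + s n * f0 + m * l)"
      using s[of n] by (simp add: field_simps)
    finally show ?thesis .
  qed
  have "\<phi> (\<lambda>w. X w + m * V w) \<le> ereal (x + m * l)"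
  proof (rule lsc_sequence[OF W _ _ le])
    show "(\<lambda>w. X w + m * V w) \<in> S" by (intro S_add S_scale X V)
    have "(\<lambda>n. (1 - s n) * x + s n * f0 + m * l) \<longlonglongrightarrow> (1 - 0) * x + 0 * f0 + m * l"
      by (intro tendsto_intros s0)
    then show "(\<lambda>n. ereal ((1 - s n) * x + s n * f0 + m * l)) \<longlonglongrightarrow> ereal (x + m * l)"
      by simp
    fix Y assume Y: "Y \<in> Sd"
    have i: "integrable M (\<lambda>w. X w * Y w)" "integrable M (\<lambda>w. V w * Y w)"
      using pairing X V Y by auto
    have eq: "integral\<^sup>L M (\<lambda>w. (a * X w + m * V w) * Y w)
        = a * integral\<^sup>L M (\<lambda>w. X w * Y w) + m * integral\<^sup>L M (\<lambda>w. V w * Y w)" for a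
      using i by (simp add: distrib_right mult.assoc)
    have "(\<lambda>n. (1 - s n) * integral\<^sup>L M (\<lambda>w. X w * Y w) + m * integral\<^sup>L M (\<lambda>w. V w * Y w))
        \<longlonglongrightarrow> (1 - 0) * integral\<^sup>L M (\<lambda>w. X w * Y w) + m * integral\<^sup>L M (\<lambda>w. V w * Y w)"
      by (intro tendsto_intros s0)
    then show "(\<lambda>n. integral\<^sup>L M (\<lambda>w. W n w * Y w)) \<longlonglongrightarrow> integral\<^sup>L M (\<lambda>w. (X w + m * V w) * Y w)"
      unfolding W_def eq using eq[of 1] by simp
  qed
  then show ?thesis by (simp add: real)
next
  case MInf
  then show ?thesis using not_MInf[OF X] by simp
qed simp

text \<open>The inequality is an equality, as it also applies to \<open>X + m W\<close> and \<open>- m\<close>; stated this way it passes to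
  weak limits by lower semicontinuity alone.\<close>

definition flat :: "('a \<Rightarrow> real) set" where
  "flat = {W \<in> S. \<forall>X\<in>S. \<forall>m. \<phi> (\<lambda>w. X w + m * W w) \<le> \<phi> X}"

lemma flat_S: "W \<in> flat \<Longrightarrow> W \<in> S"
  by (simp add: flat_def)

lemma flatD: "W \<in> flat \<Longrightarrow> X \<in> S \<Longrightarrow> \<phi> (\<lambda>w. X w + m * W w) \<le> \<phi> X"
  by (simp add: flat_def)

lemma flat_add:
  assumes "W \<in> flat" "V \<in> flat"
  shows "(\<lambda>w. W w + V w) \<in> flat"
  unfolding flat_def
proof (intro CollectI conjI ballI allI)
  show "(\<lambda>w. W w + V w) \<in> S" using assms by (intro S_add flat_S)
  fix X m assume X: "X \<in> S"
  have "\<phi> (\<lambda>w. (X w + m * W w) + m * V w) \<le> \<phi> (\<lambda>w. X w + m * W w)"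
    by (intro flatD assms S_add S_scale X flat_S)
  also have "\<dots> \<le> \<phi> X" by (intro flatD assms X)
  finally show "\<phi> (\<lambda>w. X w + m * (W w + V w)) \<le> \<phi> X" by (simp add: algebra_simps)
qed

lemma flat_scale:
  assumes "W \<in> flat"
  shows "(\<lambda>w. c * W w) \<in> flat"
  unfolding flat_def
proof (intro CollectI conjI ballI allI)
  show "(\<lambda>w. c * W w) \<in> S" using assms by (intro S_scale flat_S)
  fix X m assume X: "X \<in> S"
  show "\<phi> (\<lambda>w. X w + m * (c * W w)) \<le> \<phi> X"
    using flatD[OF assms X, of "m * c"] by (simp add: mult.assoc)
qed

lemma flat_zero: "(\<lambda>_. 0) \<in> flat"
  by (simp add: flat_def S_const)

lemma flat_sum:
  assumes "\<And>i. i \<in> I \<Longrightarrow> W i \<in> flat"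
  shows "(\<lambda>w. \<Sum>i\<in>I. W i w) \<in> flat"
  using assms by (induction I rule: infinite_finite_induct) (auto intro: flat_zero flat_add)

lemma flat_closed:
  assumes W: "\<And>n. W n \<in> flat" and V: "V \<in> S"
    and conv: "\<And>Y. Y \<in> Sd \<Longrightarrow>
      (\<lambda>n. integral\<^sup>L M (\<lambda>w. W n w * Y w)) \<longlonglongrightarrow> integral\<^sup>L M (\<lambda>w. V w * Y w)"
  shows "V \<in> flat"
  unfolding flat_def
proof (intro CollectI conjI ballI allI)
  fix X m assume X: "X \<in> S"
  show "\<phi> (\<lambda>w. X w + m * V w) \<le> \<phi> X"
  proof (rule lsc_sequence)
    show "(\<lambda>w. X w + m * W n w) \<in> S" for n by (intro S_add S_scale X flat_S W)
    show "(\<lambda>w. X w + m * V w) \<in> S" by (intro S_add S_scale X V)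
    show "\<phi> (\<lambda>w. X w + m * W n w) \<le> \<phi> X" for n by (rule flatD[OF W X])
    show "(\<lambda>_. \<phi> X) \<longlonglongrightarrow> \<phi> X" by simp
    fix Y assume Y: "Y \<in> Sd"
    have eq: "integral\<^sup>L M (\<lambda>w. (X w + m * U w) * Y w)
        = integral\<^sup>L M (\<lambda>w. X w * Y w) + m * integral\<^sup>L M (\<lambda>w. U w * Y w)" if "U \<in> S" for U
      using pairing[OF X Y] pairing[OF that Y] by (simp add: distrib_right mult.assoc)
    show "(\<lambda>n. integral\<^sup>L M (\<lambda>w. (X w + m * W n w) * Y w))
        \<longlonglongrightarrow> integral\<^sup>L M (\<lambda>w. (X w + m * V w) * Y w)"
      unfolding eq[OF flat_S[OF W]] eq[OF V] by (intro tendsto_intros conv Y)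
  qed
qed fact

text \<open>Pairings with \<open>Sd\<close> do not distinguish almost surely equal variables, so the
  constant sequence \<open>W\<close> converges weakly to \<open>V\<close>.\<close>

lemma flat_AE:
  assumes W: "W \<in> flat" and V[measurable]: "V \<in> borel_measurable M" and eq: "AE w in M. V w = W w"
  shows "V \<in> flat"
proof (rule flat_closed[of "\<lambda>_. W"])
  have [measurable]: "W \<in> borel_measurable M" using W by (intro measurable_S flat_S)
  show "V \<in> S" by (rule S_law[OF flat_S[OF W]]) (intro same_law_AE V measurable_S flat_S W eq)
  fix Y assume "Y \<in> Sd"
  then have [measurable]: "Y \<in> borel_measurable M" using integrable_dual by blast
  have "integral\<^sup>L M (\<lambda>w. W w * Y w) = integral\<^sup>L M (\<lambda>w. V w * Y w)"
    by (rule integral_cong_AE) (use eq in auto)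
  then show "(\<lambda>_. integral\<^sup>L M (\<lambda>w. W w * Y w)) \<longlonglongrightarrow> integral\<^sup>L M (\<lambda>w. V w * Y w)"
    by simp
qed (rule W)

text \<open>The dominating variable is taken from \<open>S\<close>, so its product with
  \<open>Y\<close> is integrable by the pairing and dominates the products
  \<open>W n * Y\<close>.\<close>

lemma weak_dominated_convergence:
  assumes W: "\<And>n. W n \<in> S" and V: "V \<in> S" and G: "G \<in> S"
    and lim: "AE w in M. (\<lambda>n. W n w) \<longlonglongrightarrow> V w"
    and bound: "\<And>n. AE w in M. \<bar>W n w\<bar> \<le> \<bar>G w\<bar>"
    and Y: "Y \<in> Sd"
  shows "(\<lambda>n. integral\<^sup>L M (\<lambda>w. W n w * Y w)) \<longlonglongrightarrow> integral\<^sup>L M (\<lambda>w. V w * Y w)"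
proof (rule integral_dominated_convergence[where w = "\<lambda>w. \<bar>G w * Y w\<bar>"])
  show "integrable M (\<lambda>w. \<bar>G w * Y w\<bar>)" using pairing[OF G Y] by simp
  show "(\<lambda>w. V w * Y w) \<in> borel_measurable M" "\<And>n. (\<lambda>w. W n w * Y w) \<in> borel_measurable M"
    using pairing[OF V Y] pairing[OF W Y] by auto
  show "AE w in M. (\<lambda>n. W n w * Y w) \<longlonglongrightarrow> V w * Y w"
    using lim by eventually_elim (intro tendsto_intros)
  show "AE w in M. norm (W n w * Y w) \<le> \<bar>G w * Y w\<bar>" for n
    using bound[of n] by eventually_elim (simp add: abs_mult mult_right_mono)
qed

end

section \<open>Centred random variables are directions of invariance\<close>

text \<open>Consecutive half-open slices fit together; positivity of \<open>v x\<close> makes the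
  right-hand side vanish at \<open>n = 0\<close>.\<close>

lemma sum_indicator_slices:
  fixes v :: "'a \<Rightarrow> real"
  assumes "0 \<le> d" "0 < v x"
  shows "(\<Sum>i<n. indicator {y \<in> A. real i * d < v y \<and> v y \<le> real (Suc i) * d} x :: real)
    = indicator {y \<in> A. v y \<le> real n * d} x"
proof (induction n)
  case 0
  then show ?case using assms by (simp add: indicator_def)
next
  case (Suc n)
  have "real n * d \<le> real (Suc n) * d" using assms by (simp add: mult_right_mono)
  then show ?case unfolding sum.lessThan_Suc Suc.IH by (auto simp: indicator_def)
qed

text \<open>Used to approximate the probabilities of an event and of its complement by multiples of
  one common mesh.\<close>

lemma floor_multiples_tendsto:
  assumes "0 \<le> a"
  shows "(\<lambda>n. real (nat \<lfloor>a * (real n + 1)\<rfloor>) * (1 / (real n + 1))) \<longlonglongrightarrow> a"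
proof (rule tendsto_sandwich)
  have *: "a * (real n + 1) - 1 \<le> real (nat \<lfloor>a * (real n + 1)\<rfloor>)"
    "real (nat \<lfloor>a * (real n + 1)\<rfloor>) \<le> a * (real n + 1)" for n
  proof -
    have "0 \<le> \<lfloor>a * (real n + 1)\<rfloor>" using assms by simp
    then have "real (nat \<lfloor>a * (real n + 1)\<rfloor>) = of_int \<lfloor>a * (real n + 1)\<rfloor>" by simp
    then show "a * (real n + 1) - 1 \<le> real (nat \<lfloor>a * (real n + 1)\<rfloor>)"
      "real (nat \<lfloor>a * (real n + 1)\<rfloor>) \<le> a * (real n + 1)"
      by linarith+
  qed
  show "\<forall>\<^sub>F n in sequentially. a - 1 / (real n + 1) \<le> real (nat \<lfloor>a * (real n + 1)\<rfloor>) * (1 / (real n + 1))"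
  proof (intro always_eventually allI)
    fix n
    show "a - 1 / (real n + 1) \<le> real (nat \<lfloor>a * (real n + 1)\<rfloor>) * (1 / (real n + 1))"
      using divide_right_mono[OF *(1)[of n], of "real n + 1"] by (simp add: diff_divide_distrib)
  qed
  show "\<forall>\<^sub>F n in sequentially. real (nat \<lfloor>a * (real n + 1)\<rfloor>) * (1 / (real n + 1)) \<le> a"
  proof (intro always_eventually allI)
    fix n
    show "real (nat \<lfloor>a * (real n + 1)\<rfloor>) * (1 / (real n + 1)) \<le> a"
      using divide_right_mono[OF *(2)[of n], of "real n + 1"] by simp
  qed
  have "(\<lambda>n. 1 / (real n + 1)) \<longlonglongrightarrow> 0"
    using LIMSEQ_inverse_real_of_nat by (simp add: inverse_eq_divide add.commute)
  from tendsto_diff[OF tendsto_const this] show "(\<lambda>n. a - 1 / (real n + 1)) \<longlonglongrightarrow> a" by simp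
qed simp

lemma sum_sum_diff:
  fixes c :: real
  shows "(\<Sum>i<k. \<Sum>j<m. c * (a i - b j))
    = real m * c * (\<Sum>i<k. a i) - real k * c * (\<Sum>j<m. b j)"
  by (simp add: right_diff_distrib sum_subtractf sum_distrib_left mult_ac)

section \<open>From copies of \<open>Z\<close> to all centred elements\<close>

locale affine_direction = law_invariant_lsc +
  fixes Z :: "'a \<Rightarrow> real" and f0 l :: real
  assumes Z: "Z \<in> S" and nonconst: "nonconstant M Z"
    and affine: "\<And>m. \<phi> (\<lambda>w. m * Z w) = ereal (f0 + m * l)"
begin

text \<open>By law invariance both copies have intercept \<open>f0\<close> and slope
  \<open>l\<close>. Adding \<open>m Z1\<close> raises \<phi> by at most \<open>m * l\<close>, adding
  \<open>- m Z2\<close> by at most \<open>- m * l\<close>, and the two bounds cancel.\<close>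

lemma flat_diff_copies:
  assumes "same_law M Z1 Z" "same_law M Z2 Z"
  shows "(\<lambda>w. Z1 w - Z2 w) \<in> flat"
proof -
  have S: "Z1 \<in> S" "Z2 \<in> S" using S_law[OF Z] assms by auto
  have aff: "\<phi> (\<lambda>w. m * Z1 w) = ereal (f0 + m * l)" "\<phi> (\<lambda>w. m * Z2 w) = ereal (f0 + m * l)" for m
    using \<phi>_law[OF S_scale[OF Z]] same_law_scale assms affine by metis+
  show ?thesis
    unfolding flat_def
  proof (intro CollectI conjI ballI allI)
    show "(\<lambda>w. Z1 w - Z2 w) \<in> S" by (intro S_diff S)
    fix X m assume X: "X \<in> S"
    have "\<phi> (\<lambda>w. (X w + m * Z1 w) + (- m) * Z2 w) \<le> \<phi> (\<lambda>w. X w + m * Z1 w) + ereal (- m * l)"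
      by (intro affine_translation_le[OF S(2) aff(2)] S_add S_scale X S)
    also have "\<dots> \<le> (\<phi> X + ereal (m * l)) + ereal (- m * l)"
      by (intro add_right_mono affine_translation_le[OF S(1) aff(1)] X)
    also have "\<dots> = \<phi> X" by (cases "\<phi> X") auto
    finally show "\<phi> (\<lambda>w. X w + m * (Z1 w - Z2 w)) \<le> \<phi> X" by (simp add: algebra_simps)
  qed
qed

text \<open>The events on which \<open>Z\<close> is near \<open>c\<close> or near \<open>d\<close>
  may be less likely than \<open>U\<close>. Therefore \<open>U\<close> and \<open>V\<close> are cut
  into equally likely slices small enough for both events, one swap is made per pair of slices, and
  the resulting differences of copies are added.\<close>

lemma flat_near_indicator_diff:
  assumes [measurable]: "U \<in> events" "V \<in> events" and disj: "U \<inter> V = {}"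
    and eq: "prob V = prob U" and pos: "0 < prob U"
    and cd: "c \<noteq> d" "\<And>e. 0 < e \<Longrightarrow> 0 < prob {x \<in> space M. \<bar>Z x - c\<bar> < e}"
      "\<And>e. 0 < e \<Longrightarrow> 0 < prob {x \<in> space M. \<bar>Z x - d\<bar> < e}"
    and e: "0 < e" "2 * e \<le> \<bar>c - d\<bar>"
  obtains W where "W \<in> flat"
    "AE x in M. \<bar>W x - (c - d) * (indicator U x - indicator V x)\<bar> \<le> 2 * e"
proof -
  have Zm[measurable]: "Z \<in> borel_measurable M" by (rule measurable_S[OF Z])
  let ?A = "{x \<in> space M. \<bar>Z x - c\<bar> < e}" and ?B = "{x \<in> space M. \<bar>Z x - d\<bar> < e}"
  define p where "p = min (prob ?A) (prob ?B)"
  have p: "0 < p" using cd e by (simp add: p_def)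
  \<comment> \<open>With this many slices the common probability \<delta> is at most
    \<open>p\<close>, while \<open>N\<close> of them exhaust \<open>U\<close> exactly.\<close>
  define N where "N = nat \<lceil>prob U / p\<rceil>"
  have "0 < prob U / p" using pos p by simp
  then have N: "0 < N" "prob U / p \<le> real N" unfolding N_def by (simp_all add: real_nat_ceiling_ge)
  define \<delta> where "\<delta> = prob U / real N"
  have \<delta>: "0 < \<delta>" "\<delta> \<le> p" "real N * \<delta> = prob U"
    using pos p N by (simp_all add: \<delta>_def field_simps)
  have ev: "?A \<in> events" "?B \<in> events" by measurable
  have le: "\<delta> \<le> prob ?A" "\<delta> \<le> prob ?B" using \<delta>(2) by (simp_all add: p_def)
  obtain A where A: "A \<in> events" "A \<subseteq> ?A" "prob A = \<delta>"
    by (rule nonatomic_subset_of_prob[OF nonatomic ev(1) \<delta>(1) le(1)])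
  obtain B where B: "B \<in> events" "B \<subseteq> ?B" "prob B = \<delta>"
    by (rule nonatomic_subset_of_prob[OF nonatomic ev(2) \<delta>(1) le(2)])
  have near: "\<And>x. x \<in> A \<Longrightarrow> \<bar>Z x - c\<bar> < e" "\<And>x. x \<in> B \<Longrightarrow> \<bar>Z x - d\<bar> < e" using A(2) B(2) by auto
  have AB: "A \<inter> B = {}"
  proof (intro equals0I)
    fix x assume "x \<in> A \<inter> B"
    then have "\<bar>Z x - c\<bar> < e" "\<bar>Z x - d\<bar> < e" using near[of x] by auto
    then show False using e(2) by linarith
  qed
  obtain u :: "'a \<Rightarrow> real" where u: "u \<in> borel_measurable M" "\<And>x. 0 < u x" "\<And>x. u x < prob U"
    "\<And>s t. 0 \<le> s \<Longrightarrow> s \<le> t \<Longrightarrow> t \<le> prob U \<Longrightarrow> prob {x \<in> U. s < u x \<and> u x \<le> t} = t - s"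
    using nonatomic_uniform_on[OF nonatomic assms(1) pos] by blast
  have pos_V: "0 < prob V" using pos eq by simp
  obtain v :: "'a \<Rightarrow> real" where v: "v \<in> borel_measurable M" "\<And>x. 0 < v x" "\<And>x. v x < prob V"
    "\<And>s t. 0 \<le> s \<Longrightarrow> s \<le> t \<Longrightarrow> t \<le> prob V \<Longrightarrow> prob {x \<in> V. s < v x \<and> v x \<le> t} = t - s"
    using nonatomic_uniform_on[OF nonatomic assms(2) pos_V] by blast
  have [measurable]: "u \<in> borel_measurable M" "v \<in> borel_measurable M" by (rule u(1), rule v(1))
  define Us where "Us i = {y \<in> U. real i * \<delta> < u y \<and> u y \<le> real (Suc i) * \<delta>}" for i
  define Vs where "Vs i = {y \<in> V. real i * \<delta> < v y \<and> v y \<le> real (Suc i) * \<delta>}" for i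
  let ?near = "\<lambda>i W. AE x in M. \<bar>W x - (c - d) * (indicator (Us i) x - indicator (Vs i) x)\<bar>
      \<le> 2 * e * (indicator (Us i) x + indicator (Vs i) x)"
  have ex: "\<exists>W. W \<in> flat \<and> ?near i W" if "i < N" for i
  proof -
    have "real (Suc i) * \<delta> \<le> real N * \<delta>" using that \<delta>(1) by (intro mult_right_mono) auto
    then have "real (Suc i) * \<delta> \<le> prob U" using \<delta>(3) by simp
    moreover have "0 \<le> real i * \<delta>" "real i * \<delta> \<le> real (Suc i) * \<delta>"
      using \<delta>(1) by (simp_all add: mult_right_mono)
    ultimately have "prob (Us i) = real (Suc i) * \<delta> - real i * \<delta>" "prob (Vs i) = real (Suc i) * \<delta> - real i * \<delta>"
      unfolding Us_def Vs_def using eq by (auto intro: u(4) v(4))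
    moreover have "real (Suc i) * \<delta> - real i * \<delta> = \<delta>" by (simp add: algebra_simps)
    ultimately have "prob (Us i) = \<delta>" "prob (Vs i) = \<delta>" by simp_all
    then have pr: "prob A = prob (Us i)" "prob B = prob (Us i)" "prob (Vs i) = prob (Us i)"
      using A(3) B(3) by simp_all
    have ev': "Us i \<in> events" "Vs i \<in> events" unfolding Us_def Vs_def by measurable
    have dj: "Us i \<inter> Vs i = {}" using disj by (auto simp: Us_def Vs_def)
    obtain Z1 Z2 where Z12: "same_law M Z1 Z" "same_law M Z2 Z"
      "AE x in M. \<bar>(Z1 x - Z2 x) - (c - d) * (indicator (Us i) x - indicator (Vs i) x)\<bar>
      \<le> 2 * e * (indicator (Us i) x + indicator (Vs i) x)"
      by (rule nonatomic_swap[OF nonatomic Zm A(1) B(1) ev' AB dj pr near])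
    show ?thesis
      by (intro exI[of _ "\<lambda>x. Z1 x - Z2 x"] conjI Z12(3) flat_diff_copies Z12(1,2))
  qed
  have "\<forall>i\<in>{..<N}. \<exists>W. W \<in> flat \<and> ?near i W"
    by (rule ballI, rule ex, rule lessThan_iff[THEN iffD1])
  from bchoice[OF this] obtain W where W: "\<forall>i\<in>{..<N}. W i \<in> flat \<and> ?near i (W i)"
    by (rule exE)
  have sum_Us: "(\<Sum>i<N. indicator (Us i) x :: real) = indicator U x" for x
  proof -
    have "(\<Sum>i<N. indicator (Us i) x :: real) = indicator {y \<in> U. u y \<le> real N * \<delta>} x"
      unfolding Us_def by (rule sum_indicator_slices) (use \<delta> u in auto)
    also have "{y \<in> U. u y \<le> real N * \<delta>} = U" using u(3) \<delta>(3) by (auto intro: less_imp_le)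
    finally show ?thesis .
  qed
  have sum_Vs: "(\<Sum>i<N. indicator (Vs i) x :: real) = indicator V x" for x
  proof -
    have "(\<Sum>i<N. indicator (Vs i) x :: real) = indicator {y \<in> V. v y \<le> real N * \<delta>} x"
      unfolding Vs_def by (rule sum_indicator_slices) (use \<delta> v in auto)
    also have "{y \<in> V. v y \<le> real N * \<delta>} = V" using v(3) \<delta>(3) eq by (auto intro: less_imp_le)
    finally show ?thesis .
  qed
  have "AE x in M. \<forall>i\<in>{..<N}. \<bar>W i x - (c - d) * (indicator (Us i) x - indicator (Vs i) x)\<bar>
      \<le> 2 * e * (indicator (Us i) x + indicator (Vs i) x)"
    by (rule AE_finite_allI[OF finite_lessThan]) (rule conjunct2[OF W[rule_format]])
  then have "AE x in M. \<bar>(\<Sum>i<N. W i x) - (c - d) * (indicator U x - indicator V x)\<bar> \<le> 2 * e"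
  proof eventually_elim
    case (elim x)
    have "\<bar>(\<Sum>i<N. W i x) - (c - d) * (indicator U x - indicator V x)\<bar>
        = \<bar>\<Sum>i<N. W i x - (c - d) * (indicator (Us i) x - indicator (Vs i) x)\<bar>"
      unfolding sum_Us[symmetric] sum_Vs[symmetric] by (simp only: sum_subtractf sum_distrib_left right_diff_distrib)
    also have "\<dots> \<le> (\<Sum>i<N. 2 * e * (indicator (Us i) x + indicator (Vs i) x))"
      by (rule order_trans[OF sum_abs sum_mono]) (use elim in blast)
    also have "\<dots> = 2 * e * (indicator U x + indicator V x)"
      unfolding sum_Us[symmetric] sum_Vs[symmetric] by (simp only: sum_distrib_left[symmetric] sum.distrib)
    \<comment> \<open>As \<open>U\<close> and \<open>V\<close> are disjoint, their indicators add up
      to at most 1, so the bound does not depend on \<open>N\<close>.\<close>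
    also have "\<dots> \<le> 2 * e * 1"
      using disj e(1) by (intro mult_left_mono) (auto simp: indicator_def)
    finally show ?case by simp
  qed
  moreover have "(\<lambda>x. \<Sum>i<N. W i x) \<in> flat" by (rule flat_sum) (rule conjunct1[OF W[rule_format]])
  ultimately show ?thesis by (rule that[rotated])
qed

text \<open>Letting the error of the preceding approximation tend to zero gives \<open>c - d\<close>
  times the target as an almost sure limit dominated by a constant. The limit stays in
  \<open>flat\<close>, and division by \<open>c - d\<close> finishes.\<close>

lemma flat_indicator_diff:
  assumes [measurable]: "U \<in> events" "V \<in> events" and disj: "U \<inter> V = {}" and eq: "prob V = prob U"
  shows "(\<lambda>x. indicator U x - indicator V x) \<in> flat"
proof (cases "prob U = 0")
  case True
  then have "U \<in> null_sets M" "V \<in> null_sets M" using eq by (auto simp: null_sets_def emeasure_eq_measure)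
  then have "AE x in M. x \<notin> U" "AE x in M. x \<notin> V" by (auto intro: AE_not_in)
  then have "AE x in M. indicator U x - indicator V x = (0::real)"
    by eventually_elim auto
  then show ?thesis by (intro flat_AE[OF flat_zero]) auto
next
  case False
  then have pos: "0 < prob U" by (simp add: zero_less_measure_iff)
  obtain c d where cd: "c \<noteq> d" "\<And>e. 0 < e \<Longrightarrow> 0 < prob {x \<in> space M. \<bar>Z x - c\<bar> < e}"
    "\<And>e. 0 < e \<Longrightarrow> 0 < prob {x \<in> space M. \<bar>Z x - d\<bar> < e}"
    using nonconstant_two_values[OF measurable_S[OF Z] nonconst] by blast
  let ?T = "\<lambda>x. (c - d) * (indicator U x - indicator V x)"
  define e where "e n = \<bar>c - d\<bar> / 2 * (1 / (real n + 1))" for n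
  have e: "0 < e n" "2 * e n \<le> \<bar>c - d\<bar>" for n
    using cd(1) by (simp_all add: e_def field_simps)
  have "\<exists>W. W \<in> flat \<and> (AE x in M. \<bar>W x - ?T x\<bar> \<le> 2 * e n)" for n
    by (rule flat_near_indicator_diff[OF assms pos cd e(1)[of n] e(2)[of n]]) (assumption | intro exI conjI)+
  then have "\<forall>n. \<exists>W. W \<in> flat \<and> (AE x in M. \<bar>W x - ?T x\<bar> \<le> 2 * e n)" by (rule allI)
  from choice[OF this] obtain W where "\<forall>n. W n \<in> flat \<and> (AE x in M. \<bar>W n x - ?T x\<bar> \<le> 2 * e n)"
    by (rule exE)
  then have W: "W n \<in> flat" "AE x in M. \<bar>W n x - ?T x\<bar> \<le> 2 * e n" for n
    by (simp_all only:)
  have T: "?T \<in> S" by (rule S_bounded[of _ "\<bar>c - d\<bar>"]) (auto simp: indicator_def)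
  have e0: "(\<lambda>n. 2 * e n) \<longlonglongrightarrow> 0"
  proof -
    have "(\<lambda>n. 1 / (real n + 1)) \<longlonglongrightarrow> 0"
      using LIMSEQ_inverse_real_of_nat by (simp add: inverse_eq_divide add.commute)
    from tendsto_mult_left[OF this, of "\<bar>c - d\<bar>"]
    have "(\<lambda>n. \<bar>c - d\<bar> * (1 / (real n + 1))) \<longlonglongrightarrow> 0" by simp
    moreover have "2 * e n = \<bar>c - d\<bar> * (1 / (real n + 1))" for n by (simp add: e_def field_simps)
    ultimately show ?thesis by simp
  qed
  have "?T \<in> flat"
  proof (rule flat_closed[OF W(1) T], rule weak_dominated_convergence)
    show "W n \<in> S" for n by (intro flat_S W)
    show "(\<lambda>_. 2 * \<bar>c - d\<bar>) \<in> S" by (rule S_const)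
    have all: "AE x in M. \<forall>n. \<bar>W n x - ?T x\<bar> \<le> 2 * e n" unfolding AE_all_countable using W(2) by (rule allI)
    then show "AE x in M. (\<lambda>n. W n x) \<longlonglongrightarrow> ?T x"
    proof eventually_elim
      case (elim x)
      have "(\<lambda>n. W n x - ?T x) \<longlonglongrightarrow> 0"
        by (rule Lim_null_comparison[OF _ e0]) (use elim in simp)
      then show ?case by (rule LIM_zero_cancel)
    qed
    show "AE x in M. \<bar>W n x\<bar> \<le> \<bar>2 * \<bar>c - d\<bar>\<bar>" for n
      using W(2)[of n]
    proof eventually_elim
      case (elim x)
      have "\<bar>?T x\<bar> \<le> \<bar>c - d\<bar>" by (auto simp: indicator_def)
      moreover have "\<bar>w\<bar> \<le> \<bar>2 * \<bar>c - d\<bar>\<bar>" if "\<bar>w - t\<bar> \<le> 2 * e n" "\<bar>t\<bar> \<le> \<bar>c - d\<bar>" for w t :: real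
        using that e(2)[of n] abs_triangle_ineq[of "w - t" t] by simp
      ultimately show ?case using elim by blast
    qed
  qed (rule T)
  from flat_scale[OF this, of "1 / (c - d)"] cd(1) show ?thesis by simp
qed

text \<open>\<open>A\<close> and its complement \<open>B\<close> may have incommensurable
  probabilities. Both are cut into slices of probability \<open>1 / (n + 1)\<close>, and every slice
  of \<open>A\<close> is paired with every slice of \<open>B\<close>. The weighted sum of the
  differences tends to \<open>prob B * 1_A - prob A * 1_B\<close>, which is
  \<open>1_A - prob A\<close> on \<open>space M\<close>.\<close>

lemma flat_centered_indicator:
  assumes A[measurable]: "A \<in> events"
  shows "(\<lambda>x. indicator A x - prob A) \<in> flat"
proof -
  have meas: "(\<lambda>x. indicator A x - prob A) \<in> borel_measurable M" by measurable
  consider "prob A = 0" | "prob A = 1" | "0 < prob A" "prob A < 1"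
    using prob_le_1[of A] measure_nonneg[of M A] by linarith
  then show ?thesis
  proof cases
    case 1
    then have "A \<in> null_sets M" using A by (simp add: null_sets_def emeasure_eq_measure)
    then have "AE x in M. x \<notin> A" by (rule AE_not_in)
    then have "AE x in M. indicator A x - prob A = (0::real)" by eventually_elim (simp add: 1)
    then show ?thesis by (rule flat_AE[OF flat_zero meas])
  next
    case 2
    then have "AE x in M. x \<in> A" by (rule AE_prob_1)
    then have "AE x in M. indicator A x - prob A = (0::real)" by eventually_elim (simp add: 2)
    then show ?thesis by (rule flat_AE[OF flat_zero meas])
  next
    case 3
    define B where "B = space M - A"
    have B[measurable]: "B \<in> events" and pB: "prob B = 1 - prob A" "0 < prob B"
      using prob_compl[OF A] 3 by (auto simp: B_def)
    have AB: "A \<inter> B = {}" by (auto simp: B_def)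
    obtain u :: "'a \<Rightarrow> real" where u: "u \<in> borel_measurable M" "\<And>x. 0 < u x" "\<And>x. u x < prob A"
      "\<And>s t. 0 \<le> s \<Longrightarrow> s \<le> t \<Longrightarrow> t \<le> prob A \<Longrightarrow> prob {x \<in> A. s < u x \<and> u x \<le> t} = t - s"
      using nonatomic_uniform_on[OF nonatomic A 3(1)] by blast
    obtain v :: "'a \<Rightarrow> real" where v: "v \<in> borel_measurable M" "\<And>x. 0 < v x" "\<And>x. v x < prob B"
      "\<And>s t. 0 \<le> s \<Longrightarrow> s \<le> t \<Longrightarrow> t \<le> prob B \<Longrightarrow> prob {x \<in> B. s < v x \<and> v x \<le> t} = t - s"
      using nonatomic_uniform_on[OF nonatomic B pB(2)] by blast
    have [measurable]: "u \<in> borel_measurable M" "v \<in> borel_measurable M" by (rule u(1), rule v(1))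
    define \<delta> where "\<delta> n = 1 / (real n + 1)" for n
    \<comment> \<open>The numbers of whole slices that fit into \<open>A\<close> and
      \<open>B\<close>; what is left over disappears in the limit.\<close>
    define k where "k n = nat \<lfloor>prob A * (real n + 1)\<rfloor>" for n
    define m where "m n = nat \<lfloor>prob B * (real n + 1)\<rfloor>" for n
    have k: "(\<lambda>n. real (k n) * \<delta> n) \<longlonglongrightarrow> prob A" and m: "(\<lambda>n. real (m n) * \<delta> n) \<longlonglongrightarrow> prob B"
      unfolding k_def m_def \<delta>_def by (rule floor_multiples_tendsto measure_nonneg)+
    have \<delta>: "0 < \<delta> n" for n by (simp add: \<delta>_def)
    have le: "real (nat \<lfloor>p * (real n + 1)\<rfloor>) * \<delta> n \<le> p" if "0 \<le> p" for p n
    proof -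
      have "real (nat \<lfloor>p * (real n + 1)\<rfloor>) \<le> p * (real n + 1)"
        using that by (intro of_nat_floor) simp
      then show ?thesis by (simp add: \<delta>_def field_simps)
    qed
    have k_le: "real (k n) * \<delta> n \<le> prob A" and m_le: "real (m n) * \<delta> n \<le> prob B" for n
      unfolding k_def m_def by (rule le[OF measure_nonneg])+
    define As where "As n i = {x \<in> A. real i * \<delta> n < u x \<and> u x \<le> real (Suc i) * \<delta> n}" for n i
    define Bs where "Bs n i = {x \<in> B. real i * \<delta> n < v x \<and> v x \<le> real (Suc i) * \<delta> n}" for n i
    have mem: "(\<lambda>x. indicator (As n i) x - indicator (Bs n j) x) \<in> flat" if "i < k n" "j < m n" for n i j
    proof (rule flat_indicator_diff)
      show "As n i \<in> events" "Bs n j \<in> events" unfolding As_def Bs_def by measurable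
      show "As n i \<inter> Bs n j = {}" using AB by (auto simp: As_def Bs_def)
      have "real (Suc i) * \<delta> n \<le> real (k n) * \<delta> n" "real (Suc j) * \<delta> n \<le> real (m n) * \<delta> n"
        using that \<delta>[of n] by (intro mult_right_mono; simp)+
      then have "real (Suc i) * \<delta> n \<le> prob A" "real (Suc j) * \<delta> n \<le> prob B"
        using k_le[of n] m_le[of n] by linarith+
      moreover have "0 \<le> real i * \<delta> n" "real i * \<delta> n \<le> real (Suc i) * \<delta> n" for i
        using \<delta>[of n] by (simp_all add: mult_right_mono)
      ultimately have "prob (As n i) = real (Suc i) * \<delta> n - real i * \<delta> n"
        "prob (Bs n j) = real (Suc j) * \<delta> n - real j * \<delta> n"
        unfolding As_def Bs_def by (auto intro: u(4) v(4))
      moreover have "real (Suc i) * \<delta> n - real i * \<delta> n = \<delta> n" for i by (simp add: algebra_simps)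
      ultimately show "prob (Bs n j) = prob (As n i)" by simp
    qed
    \<comment> \<open>Each slice of \<open>A\<close> occurs once per slice of \<open>B\<close>, that
      is \<open>m n\<close> times; the weight \<open>\<delta> n\<close> turns this multiplicity into
      an approximation of \<open>prob B\<close>. On \<open>B\<close> the multiplicity is
      \<open>k n\<close>, approximating \<open>prob A\<close>.\<close>
    define W where "W n x = (\<Sum>i<k n. \<Sum>j<m n. \<delta> n * (indicator (As n i) x - indicator (Bs n j) x :: real))" for n x
    have W: "W n \<in> flat" for n
      unfolding W_def by (intro flat_sum flat_scale mem) auto
    have W_eq: "W n x = real (m n) * \<delta> n * indicator {y \<in> A. u y \<le> real (k n) * \<delta> n} x
        - real (k n) * \<delta> n * indicator {y \<in> B. v y \<le> real (m n) * \<delta> n} x" for n x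
    proof -
      have "W n x = real (m n) * \<delta> n * (\<Sum>i<k n. indicator (As n i) x)
          - real (k n) * \<delta> n * (\<Sum>j<m n. indicator (Bs n j) x)"
        unfolding W_def by (rule sum_sum_diff)
      also have "(\<Sum>i<k n. indicator (As n i) x :: real) = indicator {y \<in> A. u y \<le> real (k n) * \<delta> n} x"
        unfolding As_def by (rule sum_indicator_slices) (use \<delta>[of n] u in auto)
      also have "(\<Sum>j<m n. indicator (Bs n j) x :: real) = indicator {y \<in> B. v y \<le> real (m n) * \<delta> n} x"
        unfolding Bs_def by (rule sum_indicator_slices) (use \<delta>[of n] v in auto)
      finally show ?thesis .
    qed
    have lim: "(\<lambda>n. W n x) \<longlonglongrightarrow> prob B * indicator A x - prob A * indicator B x" for x
    proof -
      \<comment> \<open>Since \<open>w x\<close> lies strictly below the limit of the thresholds,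
        \<open>x\<close> is covered by the slices from some \<open>n\<close> on whenever it belongs
        to \<open>C\<close>.\<close>
      have ind: "(\<lambda>n. indicator {y \<in> C. w y \<le> s n} x :: real) \<longlonglongrightarrow> indicator C x"
        if "s \<longlonglongrightarrow> p" "w x < p" for C p and s :: "nat \<Rightarrow> real" and w :: "'a \<Rightarrow> real"
      proof (rule tendsto_eventually)
        from order_tendstoD(1)[OF that]
        show "\<forall>\<^sub>F n in sequentially. (indicator {y \<in> C. w y \<le> s n} x :: real) = indicator C x"
          by eventually_elim (auto simp: indicator_def)
      qed
      show ?thesis
        unfolding W_eq by (intro tendsto_intros k m ind[OF k u(3)] ind[OF m v(3)])
    qed
    have "(\<lambda>x. prob B * indicator A x - prob A * indicator B x) \<in> flat"
    proof (rule flat_closed[OF W], rule S_bounded[of _ 2])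
      have le1: "\<bar>a * indicator C x - b * indicator D x\<bar> \<le> 2"
        if "0 \<le> a" "a \<le> 1" "0 \<le> b" "b \<le> 1" for a b :: real and C D :: "'a set" and x
        using that by (auto simp: indicator_def)
      show le2: "\<bar>prob B * indicator A x - prob A * indicator B x\<bar> \<le> 2" for x
        by (rule le1) auto
      show "(\<lambda>x. prob B * indicator A x - prob A * indicator B x) \<in> borel_measurable M" by measurable
      fix Y assume Y: "Y \<in> Sd"
      show "(\<lambda>n. integral\<^sup>L M (\<lambda>w. W n w * Y w))
        \<longlonglongrightarrow> integral\<^sup>L M (\<lambda>w. (prob B * indicator A w - prob A * indicator B w) * Y w)"
      proof (rule weak_dominated_convergence[OF _ _ _ _ _ Y])
        show "W n \<in> S" for n by (intro flat_S W)
        show "(\<lambda>x. prob B * indicator A x - prob A * indicator B x) \<in> S"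
          by (rule S_bounded[OF _ le2]) measurable
        show "(\<lambda>_. 2) \<in> S" by (rule S_const)
        show "AE x in M. (\<lambda>n. W n x) \<longlonglongrightarrow> prob B * indicator A x - prob A * indicator B x"
          using lim by simp
        have "real (k n) * \<delta> n \<le> 1" "real (m n) * \<delta> n \<le> 1" for n
          using k_le[of n] m_le[of n] prob_le_1[of A] prob_le_1[of B] by linarith+
        then have "\<bar>W n x\<bar> \<le> 2" for n x
          unfolding W_eq using \<delta>[of n] by (intro le1) auto
        then show "AE x in M. \<bar>W n x\<bar> \<le> \<bar>2\<bar>" for n by simp
      qed
    qed
    moreover have "AE x in M. indicator A x - prob A = prob B * indicator A x - prob A * indicator B x"
      using AE_space by eventually_elim (auto simp: B_def pB[unfolded B_def] indicator_def)
    ultimately show ?thesis by (rule flat_AE[OF _ meas])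
  qed
qed

text \<open>A finite combination of centred indicators of level sets. The representation of
  \<open>s\<close> holds only on \<open>space M\<close>, hence the passage through almost sure
  equality.\<close>

lemma flat_centered_simple:
  fixes s :: "'a \<Rightarrow> real"
  assumes s: "simple_function M s"
  shows "(\<lambda>x. s x - expectation s) \<in> flat"
proof -
  have [measurable]: "s \<in> borel_measurable M" using s by (rule borel_measurable_simple_function)
  have ev: "s -` {y} \<inter> space M \<in> events" for y by measurable
  have rep: "s x = (\<Sum>y\<in>s ` space M. y * indicator (s -` {y} \<inter> space M) x)" if "x \<in> space M" for x
    by (rule trans[OF simple_function_indicator_representation_banach[OF s that]])
      (simp only: real_scaleR_def mult.commute)
  have "expectation s = expectation (\<lambda>x. \<Sum>y\<in>s ` space M. y * indicator (s -` {y} \<inter> space M) x)"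
    by (rule Bochner_Integration.integral_cong[OF refl rep])
  also have "\<dots> = (\<Sum>y\<in>s ` space M. y * prob (s -` {y} \<inter> space M))"
    using ev by (subst Bochner_Integration.integral_sum) (auto simp: emeasure_eq_measure Int_absorb2)
  finally have E: "expectation s = (\<Sum>y\<in>s ` space M. y * prob (s -` {y} \<inter> space M))" .
  have mem: "(\<lambda>x. \<Sum>y\<in>s ` space M. y * (indicator (s -` {y} \<inter> space M) x - prob (s -` {y} \<inter> space M))) \<in> flat"
    by (intro flat_sum flat_scale flat_centered_indicator ev)
  have "AE x in M. s x - expectation s
      = (\<Sum>y\<in>s ` space M. y * (indicator (s -` {y} \<inter> space M) x - prob (s -` {y} \<inter> space M)))"
    using AE_space
  proof eventually_elim
    case (elim x)
    show ?case unfolding E rep[OF elim] by (simp add: right_diff_distrib sum_subtractf)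
  qed
  then show ?thesis by (rule flat_AE[OF mem, rotated]) measurable
qed

text \<open>Simple functions bounded by \<open>2 * X\<close> in modulus approximate
  \<open>X\<close>. As \<open>2 * X\<close> is in \<open>S\<close>, they converge weakly, and
  testing against the constant 1 gives convergence of the subtracted means.\<close>

lemma flat_centered:
  assumes X: "X \<in> S"
  shows "(\<lambda>x. X x - expectation X) \<in> flat"
proof -
  have Xm[measurable]: "X \<in> borel_measurable M" by (rule measurable_S[OF X])
  obtain s where s: "\<And>i. simple_function M (s i)" "\<And>x. x \<in> space M \<Longrightarrow> (\<lambda>i. s i x) \<longlonglongrightarrow> X x"
    "\<And>i x. x \<in> space M \<Longrightarrow> dist (s i x) 0 \<le> 2 * dist (X x) 0"
    using borel_measurable_implies_sequence_metric[OF Xm, of 0] by blast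
  have sm[measurable]: "s i \<in> borel_measurable M" for i by (rule borel_measurable_simple_function[OF s(1)])
  have sS: "s i \<in> S" for i
  proof -
    have "(\<lambda>x. s i x - expectation (s i)) \<in> S" by (intro flat_S flat_centered_simple s)
    from S_add[OF this S_const[of "expectation (s i)"]] show ?thesis by simp
  qed
  have conv: "(\<lambda>n. integral\<^sup>L M (\<lambda>w. s n w * Y w)) \<longlonglongrightarrow> integral\<^sup>L M (\<lambda>w. X w * Y w)" if "Y \<in> Sd" for Y
  proof (rule weak_dominated_convergence[OF sS X S_scale[OF X, of 2] _ _ that])
    show "AE x in M. (\<lambda>n. s n x) \<longlonglongrightarrow> X x" using s(2) by (rule AE_I2)
    show "AE x in M. \<bar>s n x\<bar> \<le> \<bar>2 * X x\<bar>" for n using s(3) by (intro AE_I2) (simp add: dist_real_def abs_mult)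
  qed
  have convE: "(\<lambda>n. expectation (s n)) \<longlonglongrightarrow> expectation X" using conv[OF one_dual] by simp
  show ?thesis
  proof (rule flat_closed[OF flat_centered_simple[OF s(1)] S_diff[OF X S_const]])
    fix Y assume Y: "Y \<in> Sd"
    have eq: "integral\<^sup>L M (\<lambda>w. (V w - a) * Y w) = integral\<^sup>L M (\<lambda>w. V w * Y w) - a * integral\<^sup>L M Y"
      if "V \<in> S" for V a
      using pairing[OF that Y] integrable_dual[OF Y] by (simp add: left_diff_distrib)
    show "(\<lambda>n. integral\<^sup>L M (\<lambda>w. (s n w - expectation (s n)) * Y w))
      \<longlonglongrightarrow> integral\<^sup>L M (\<lambda>w. (X w - expectation X) * Y w)"
      unfolding eq[OF sS] eq[OF X] by (intro tendsto_intros conv[OF Y] convE)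
  qed
qed

text \<open>\<open>X\<close> and its mean differ by a direction in \<open>flat\<close>, which is
  followed with coefficients 1 and -1.\<close>

lemma \<phi>_expectation:
  assumes X: "X \<in> S"
  shows "\<phi> X = \<phi> (\<lambda>_. expectation X)"
proof (rule antisym)
  show "\<phi> X \<le> \<phi> (\<lambda>_. expectation X)"
    using flatD[OF flat_centered[OF X] S_const[of "expectation X"], of 1] by simp
  show "\<phi> (\<lambda>_. expectation X) \<le> \<phi> X"
    using flatD[OF flat_centered[OF X] X, of "-1"] by simp
qed

lemma \<phi>_linear:
  assumes X: "X \<in> S" and EZ: "expectation Z \<noteq> 0"
  shows "\<phi> X = ereal (l / expectation Z * expectation X + f0)"
proof -
  \<comment> \<open>The multiple of \<open>Z\<close> that has the same mean as \<open>X\<close>; it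
    exists because the mean of \<open>Z\<close> is nonzero.\<close>
  let ?m = "expectation X / expectation Z"
  have "\<phi> (\<lambda>w. ?m * Z w) = \<phi> (\<lambda>_. expectation (\<lambda>w. ?m * Z w))"
    by (rule \<phi>_expectation[OF S_scale[OF Z]])
  also have "expectation (\<lambda>w. ?m * Z w) = expectation X" using EZ by simp
  finally show ?thesis unfolding \<phi>_expectation[OF X] affine by (simp add: field_simps)
qed

end

section \<open>The equivalence\<close>

context law_invariant_lsc
begin

lemma affine_along_imp_expectation:
  assumes Z: "Z \<in> S" "nonconstant M Z" and EZ: "expectation Z \<noteq> 0"
    and aff: "affine_along (rv_span Z) \<phi>"
  shows "\<exists>a. \<forall>X\<in>S. \<phi> X = ereal (a * expectation X) + \<phi> (\<lambda>_. 0)"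
proof -
  have span: "(\<lambda>w. m * Z w) \<in> rv_span Z" for m by (auto simp: rv_span_def)
  have fin: "\<exists>r. \<phi> (\<lambda>w. m * Z w) = ereal r" for m
  proof -
    have "\<phi> (\<lambda>w. m * Z w) < \<infinity>" using aff span unfolding affine_along_def by blast
    moreover have "\<phi> (\<lambda>w. m * Z w) \<noteq> - \<infinity>" by (rule not_MInf[OF S_scale[OF Z(1)]])
    ultimately show ?thesis by (cases "\<phi> (\<lambda>w. m * Z w)") auto
  qed
  obtain f0 where f0: "\<phi> (\<lambda>_. 0) = ereal f0" using fin[of 0] by auto
  obtain z where z: "\<phi> Z = ereal z" using fin[of 1] by auto
  have affine: "\<phi> (\<lambda>w. m * Z w) = ereal (f0 + m * (z - f0))" for m
  proof -
    have "Z \<in> rv_span Z" using span[of 1] by simp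
    \<comment> \<open>Both vectors in the affinity condition are taken to be \<open>Z\<close>, with
      coefficients \<open>m\<close> and 0, which reads off the slope \<open>z - f0\<close>.\<close>
    then have "\<phi> (\<lambda>w. m * Z w + 0 * Z w) - \<phi> (\<lambda>_. 0) = ereal m * (\<phi> Z - \<phi> (\<lambda>_. 0)) + ereal 0 * (\<phi> Z - \<phi> (\<lambda>_. 0))"
      using aff unfolding affine_along_def by blast
    moreover obtain r where "\<phi> (\<lambda>w. m * Z w) = ereal r" using fin by blast
    ultimately show ?thesis by (simp add: f0 z)
  qed
  interpret affine_direction M S Sd \<phi> Z f0 "z - f0"
    by unfold_locales (use Z affine in auto)
  show ?thesis using \<phi>_linear[OF _ EZ] f0 by (intro exI[of _ "(z - f0) / expectation Z"]) auto
qed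

text \<open>The formula makes all values finite, so the extended-real identities reduce to linearity
  of the expectation.\<close>

lemma expectation_imp_translation_invariant:
  assumes \<phi>: "\<And>X. X \<in> S \<Longrightarrow> \<phi> X = ereal (a * expectation X + f0)" and N: "N \<subseteq> S"
  shows "translation_invariant_along S N \<phi>"
proof -
  have "\<phi> (\<lambda>w. b * X w + c * Y w) = ereal (a * (b * expectation X + c * expectation Y) + f0)"
    if "X \<in> S" "Y \<in> S" for X Y b c
    using \<phi>[OF S_add[OF S_scale[OF that(1)] S_scale[OF that(2)], of b c]] that by (simp add: integrable_S)
  note comb = this
  have zero: "\<phi> (\<lambda>_. 0) = ereal f0" using \<phi>[OF S_const[of 0]] by simp
  have "affine_along N \<phi>"
    unfolding affine_along_def
  proof (intro conjI ballI allI)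
    fix X assume "X \<in> N"
    then show "\<phi> X < \<infinity>" using \<phi>[of X] N by auto
  next
    fix X Y b c assume "X \<in> N" "Y \<in> N"
    then have "X \<in> S" "Y \<in> S" using N by auto
    then show "\<phi> (\<lambda>w. b * X w + c * Y w) - \<phi> (\<lambda>_. 0)
        = ereal b * (\<phi> X - \<phi> (\<lambda>_. 0)) + ereal c * (\<phi> Y - \<phi> (\<lambda>_. 0))"
      by (simp add: comb \<phi> zero algebra_simps)
  qed
  moreover have "\<phi> (\<lambda>w. X w + Y w) = \<phi> X + \<phi> Y - \<phi> (\<lambda>_. 0)" if "X \<in> S" "Y \<in> N" for X Y
  proof -
    have "Y \<in> S" using that N by auto
    then show ?thesis using comb[OF that(1), of Y 1 1] that(1) by (simp add: \<phi> zero algebra_simps)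
  qed
  ultimately show ?thesis by (simp add: translation_invariant_along_def)
qed

text \<open>Supplies the direction needed to return from the formula to translation invariance:
  splitting the whole space gives an event of probability strictly between 0 and 1. Its indicator
  cannot be constant, as the constant would equal this probability.\<close>

lemma ex_nonconstant:
  obtains Z where "Z \<in> S" "nonconstant M Z" "expectation Z \<noteq> 0"
proof -
  obtain B where B: "B \<in> events" "0 < prob B" "prob B < 1"
    using nonatomic prob_space unfolding nonatomic_def by (metis sets.top zero_less_one)
  have EB: "expectation (indicator B) = prob B"
    using sets.sets_into_space[OF B(1)] by (simp add: Int_absorb2)
  have "nonconstant M (indicator B)"
    unfolding nonconstant_def
  proof
    assume "\<exists>c::real. AE w in M. indicator B w = c"
    then obtain c :: real where c: "AE w in M. indicator B w = c" by blast
    have "expectation (indicator B) = expectation (\<lambda>_. c)"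
      by (rule integral_cong_AE) (use c B in auto)
    then have "c = prob B" using EB prob_space by simp
    then have "0 < c" "c < 1" using B by simp_all
    then have "AE w in M. False"
      by (intro eventually_mono[OF c]) (auto simp: indicator_def split: if_splits)
    then show False by simp
  qed
  moreover have "indicator B \<in> S"
    by (rule S_bounded[of _ 1]) (use B in \<open>auto simp: indicator_def\<close>)
  ultimately show ?thesis using that[of "indicator B"] EB B(2) by simp
qed

end

theorem theorem4p5:
  fixes M :: "'a measure" and S Sd :: "('a \<Rightarrow> real) set"
    and \<phi> :: "('a \<Rightarrow> real) \<Rightarrow> ereal"
  assumes "prob_space M" and "nonatomic M"
    and "linear_subspace_rv S" and "linear_subspace_rv Sd"
    and "law_invariant_set M S" and "law_invariant_set M Sd"
    and "subset_L1 M S" and "subset_L1 M Sd"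
    and "contains_Linf M S" and "contains_Linf M Sd"
    and "\<forall>X\<in>S. \<forall>Y\<in>Sd. integrable M (\<lambda>w. X w * Y w)"
    and "\<forall>X\<in>S. \<phi> X \<noteq> -\<infinity>"
    and "proper_on S \<phi>" and "convex_on_rv S \<phi>"
    and "weak_lsc M S Sd \<phi>" and "law_invariant_fun M S \<phi>"
  shows "((\<exists>Z\<in>S. nonconstant M Z \<and> integral\<^sup>L M Z \<noteq> 0 \<and> affine_along (rv_span Z) \<phi>)
            \<longleftrightarrow> (\<exists>Z\<in>S. nonconstant M Z \<and> integral\<^sup>L M Z \<noteq> 0 \<and>
                        translation_invariant_along S (rv_span Z) \<phi>))
       \<and> ((\<exists>Z\<in>S. nonconstant M Z \<and> integral\<^sup>L M Z \<noteq> 0 \<and>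
                        translation_invariant_along S (rv_span Z) \<phi>)
            \<longleftrightarrow> (\<exists>a::real. \<forall>X\<in>S. \<phi> X = ereal (a * integral\<^sup>L M X) + \<phi> (\<lambda>_. 0)))"
  (is "(?a \<longleftrightarrow> ?b) \<and> (?b \<longleftrightarrow> ?c)")
proof -
  interpret prob_space M by fact
  interpret law_invariant_lsc M S Sd \<phi>
    by unfold_locales (use assms in auto)
  have "?b \<Longrightarrow> ?a" unfolding translation_invariant_along_def by blast
  moreover have "?a \<Longrightarrow> ?c" using affine_along_imp_expectation by blast
  moreover have "?b" if c: "?c"
  proof -
    obtain a where a: "\<And>X. X \<in> S \<Longrightarrow> \<phi> X = ereal (a * expectation X) + \<phi> (\<lambda>_. 0)" using c by blast
    obtain X where X: "X \<in> S" "\<phi> X < \<infinity>" using assms(13) by (auto simp: proper_on_def)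
    \<comment> \<open>Properness enters here: an infinite value at 0 would, by the formula, make
      \<phi> infinite on all of \<open>S\<close>.\<close>
    have "\<phi> (\<lambda>_. 0) \<noteq> \<infinity>" using a[OF X(1)] X(2) by auto
    then obtain f0 where "\<phi> (\<lambda>_. 0) = ereal f0"
      using not_MInf[OF S_const[of 0]] by (cases "\<phi> (\<lambda>_. 0)") auto
    with a have "\<phi> X = ereal (a * expectation X + f0)" if "X \<in> S" for X using that by simp
    moreover obtain Z where Z: "Z \<in> S" "nonconstant M Z" "expectation Z \<noteq> 0" by (rule ex_nonconstant)
    moreover have "rv_span Z \<subseteq> S" using S_scale[OF Z(1)] by (auto simp: rv_span_def)
    ultimately show ?thesis using expectation_imp_translation_invariant by blast
  qed
  ultimately show ?thesis by blast
qed

end
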